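(* Let $\mathrm{Re}$ and $m$ be real constants, let $W_2^5[0,1]$, $W_2^4[0,1]$, $L$, $M$ be as defined in the context, let $\{x_i\}_{i=1}^\infty$ be a dense set in $[0,1]$, and let $\{\overline{\Psi}_i\}_{i=1}^\infty$ and $\beta_{ik}$ be the orthonormal system and the orthogonalization coefficients defined in the context. If $u\in W_2^5[0,1]$ is the exact solution of the boundary value problem $$Lu(x)=M\bigl(x,u(x),u^{(3)}(x)\bigr),\quad x\in[0,1],\qquad u(0)=0,\ u(1)=0,\ u'(1)=0,\ u''(0)=0,$$ then $$u(x)=\sum_{i=1}^{\infty}\sum_{k=1}^{i}\beta_{ik}\,M\bigl(x_k,u(x_k),u^{(3)}(x_k)\bigr)\,\overline{\Psi}_i(x).$$
   Context: All functions are real-valued on $[0,1]$. $W_2^5[0,1]$ is the space of functions $u$ such that $u,u',u'',u''',u^{(4)}$ are absolutely continuous on $[0,1]$, $u^{(5)}\in L^2[0,1]$, and $u(0)=u(1)=u'(1)=u''(0)=0$, with inner product $\langle u,v\rangle_{W_2^5}=\sum_{i=0}^4u^{(i)}(0)v^{(i)}(0)+\int_0^1u^{(5)}(x)v^{(5)}(x)\,dx$. $W_2^4[0,1]$ is the space of functions $u$ such that $u,u',u'',u'''$ are absolutely continuous on $[0,1]$ and $u^{(4)}\in L^2[0,1]$, with inner product $\langle u,v\rangle_{W_2^4}=\sum_{i=0}^3u^{(i)}(0)v^{(i)}(0)+\int_0^1u^{(4)}(x)v^{(4)}(x)\,dx$. It is a reproducing kernel Hilbert space; $r_y$ denotes its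 reproducing kernel function, i.e. $u(y)=\langle u,r_y\rangle_{W_2^4}$ for all $u\in W_2^4[0,1]$ and $y\in[0,1]$. The linear operator $L:W_2^5[0,1]\to W_2^4[0,1]$ is $$Lu(x)=u^{(4)}(x)+\mathrm{Re}\,\frac{e^x}{e}(x^3-4x^2+4x)\,u^{(3)}(x)-m^2u''(x)+\mathrm{Re}\,\frac{e^x}{e}(x^3+5x^2-2x-6)\,u(x),$$ and $$M(x,u,u^{(3)})=-\mathrm{Re}\,u^{(3)}(x)u(x)-\mathrm{Re}\Bigl(\frac{e^x}{e}\Bigr)^2(x^3-4x^2+4x)(x^3+5x^2-2x-6)-\frac{e^x}{e}(x^3+8x^2+8x-8)+m^2\frac{e^x}{e}(x^3+2x^2-6x).$$ $L^*$ denotes the adjoint operator of $L$, and $\Psi_i=L^*r_{x_i}$ for $i\ge1$. The orthonormal system $\{\overline{\Psi}_i\}_{i=1}^\infty$ of $W_2^5[0,1]$ is obtained from $\{\Psi_i\}_{i=1}^\infty$ by Gram–Schmidt orthonormalization: $\overline{\Psi}_i=\sum_{k=1}^i\beta_{ik}\Psi_k$ with $\beta_{ii}>0$, where the $\beta_{ik}$ are the orthogonalization coefficients.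
   Formalization: Since L does not map all of W_2^5 into W_2^4 (Lu contains u^{(4)}), L is taken as the densely defined operator with domain {v in W_2^5 : Lv in W_2^4}, and L^* is the usual Hilbert-space adjoint of that operator. *)

theory Defs
  imports "HOL-Analysis.Analysis"
begin

text \<open>
  Functions on the unit interval are represented by functions of type
  \<open>real \<Rightarrow> real\<close>; their values outside \<open>{0..1}\<close> are irrelevant everywhere below.
  At the endpoints the derivative is one-sided.
\<close>

definition D :: "(real \<Rightarrow> real) \<Rightarrow> real \<Rightarrow> real" where
  "D u x = vector_derivative u (at x within {0..1})"

definition abs_continuous_on :: "real set \<Rightarrow> (real \<Rightarrow> real) \<Rightarrow> bool" where
  "abs_continuous_on S f \<longleftrightarrow>
     (\<forall>\<epsilon>>0. \<exists>\<delta>>0. \<forall>(n::nat) a b.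
        (\<forall>i<n. a i \<le> b i \<and> {a i..b i} \<subseteq> S) \<and>
        disjoint_family_on (\<lambda>i. {a i<..<b i}) {..<n} \<and>
        (\<Sum>i<n. b i - a i) < \<delta> \<longrightarrow>
        (\<Sum>i<n. \<bar>f (b i) - f (a i)\<bar>) < \<epsilon>)"

definition square_integrable01 :: "(real \<Rightarrow> real) \<Rightarrow> bool" where
  "square_integrable01 f \<longleftrightarrow>
     f \<in> borel_measurable (lebesgue_on {0..1}) \<and>
     integrable (lebesgue_on {0..1}) (\<lambda>x. (f x)\<^sup>2)"

text \<open>
  \<open>vector_derivative\<close> is total, so the existence of the derivatives of order
  \<open>1, \<dots>, n - 1\<close> everywhere is stated explicitly, and so is the existence of the derivative
  of order \<open>n\<close> almost everywhere; the latter is automatic for an absolutely continuous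
  function and only makes explicit that the last condition is about the actual derivative.
\<close>

definition sobolev :: "nat \<Rightarrow> (real \<Rightarrow> real) set" where
  "sobolev n = {u.
     (\<forall>k<n - 1. (D ^^ k) u differentiable_on {0..1}) \<and>
     (\<forall>k<n. abs_continuous_on {0..1} ((D ^^ k) u)) \<and>
     (AE x in lebesgue_on {0..1}. (D ^^ (n - 1)) u differentiable (at x within {0..1})) \<and>
     square_integrable01 ((D ^^ n) u)}"

definition sobolev_inner :: "nat \<Rightarrow> (real \<Rightarrow> real) \<Rightarrow> (real \<Rightarrow> real) \<Rightarrow> real" where
  "sobolev_inner n u v =
     (\<Sum>i<n. (D ^^ i) u 0 * (D ^^ i) v 0) +
     integral\<^sup>L (lebesgue_on {0..1}) (\<lambda>x. (D ^^ n) u x * (D ^^ n) v x)"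

definition W4 :: "(real \<Rightarrow> real) set" where
  "W4 = sobolev 4"

definition W5 :: "(real \<Rightarrow> real) set" where
  "W5 = {u \<in> sobolev 5. u 0 = 0 \<and> u 1 = 0 \<and> D u 1 = 0 \<and> (D ^^ 2) u 0 = 0}"

definition reproducing_kernel ::
  "(real \<Rightarrow> real) set \<Rightarrow> ((real \<Rightarrow> real) \<Rightarrow> (real \<Rightarrow> real) \<Rightarrow> real) \<Rightarrow> (real \<Rightarrow> real \<Rightarrow> real) \<Rightarrow> bool" where
  "reproducing_kernel H ip r \<longleftrightarrow>
     (\<forall>y\<in>{0..1}. r y \<in> H \<and> (\<forall>u\<in>H. u y = ip u (r y)))"

definition L_op :: "real \<Rightarrow> real \<Rightarrow> (real \<Rightarrow> real) \<Rightarrow> real \<Rightarrow> real" where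
  "L_op R m u x =
     (D ^^ 4) u x
     + R * (exp x / exp 1) * (x^3 - 4 * x^2 + 4 * x) * (D ^^ 3) u x
     - m^2 * (D ^^ 2) u x
     + R * (exp x / exp 1) * (x^3 + 5 * x^2 - 2 * x - 6) * u x"

definition M_fun :: "real \<Rightarrow> real \<Rightarrow> real \<Rightarrow> real \<Rightarrow> real \<Rightarrow> real" where
  "M_fun R m x u0 u3 =
     - R * u3 * u0
     - R * (exp x / exp 1)^2 * (x^3 - 4 * x^2 + 4 * x) * (x^3 + 5 * x^2 - 2 * x - 6)
     - (exp x / exp 1) * (x^3 + 8 * x^2 + 8 * x - 8)
     + m^2 * (exp x / exp 1) * (x^3 + 2 * x^2 - 6 * x)"

text \<open>
  \<open>L_op R m\<close> has order 4, so it does not send every element of \<open>W5\<close> into \<open>W4\<close>.  As an operator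
  from \<open>W5\<close> to \<open>W4\<close> it is the (densely defined) operator with domain \<open>{v \<in> W5. T v \<in> W4}\<close>
  for \<open>T = L_op R m\<close>, and its adjoint is the usual Hilbert space adjoint of a densely defined
  operator: \<open>w\<close> is in the domain of the adjoint with value \<open>z\<close> iff \<open>\<langle>T v, w\<rangle> = \<langle>v, z\<rangle>\<close> for all \<open>v\<close>
  in the domain.  The value \<open>z\<close> is unique on \<open>{0..1}\<close> by density.
\<close>

definition adjoint_value ::
  "((real \<Rightarrow> real) \<Rightarrow> real \<Rightarrow> real) \<Rightarrow> (real \<Rightarrow> real) \<Rightarrow> (real \<Rightarrow> real) \<Rightarrow> bool" where
  "adjoint_value T w z \<longleftrightarrow>
     w \<in> W4 \<and> z \<in> W5 \<and>
     (\<forall>v\<in>W5. T v \<in> W4 \<longrightarrow> sobolev_inner 4 (T v) w = sobolev_inner 5 v z)"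

text \<open>
  Sequences are indexed by \<open>i \<ge> 1\<close>.  Triangularity, positive diagonal and orthonormality
  determine the Gram-Schmidt coefficients; they force the \<open>\<Psi> i\<close> to be linearly independent.
\<close>

definition gram_schmidt ::
  "((real \<Rightarrow> real) \<Rightarrow> (real \<Rightarrow> real) \<Rightarrow> real) \<Rightarrow> (nat \<Rightarrow> real \<Rightarrow> real) \<Rightarrow>
   (nat \<Rightarrow> nat \<Rightarrow> real) \<Rightarrow> (nat \<Rightarrow> real \<Rightarrow> real) \<Rightarrow> bool" where
  "gram_schmidt ip \<Psi> \<beta> \<Psi>o \<longleftrightarrow>
     (\<forall>i\<ge>1. \<beta> i i > 0 \<and> (\<forall>t\<in>{0..1}. \<Psi>o i t = (\<Sum>k=1..i. \<beta> i k * \<Psi> k t))) \<and>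
     (\<forall>i\<ge>1. \<forall>j\<ge>1. ip (\<Psi>o i) (\<Psi>o j) = (if i = j then 1 else 0))"

end

theory Submission
  imports Defs
begin

text \<open>
  Put \<open>c\<^sub>i = \<langle>u, \<Psi>o\<^sub>i\<rangle>\<close>.  The adjoint relation and the reproducing property give \<open>(L v)(x\<^sub>i) = \<langle>v, \<Psi>\<^sub>i\<rangle>\<close>,
  first for polynomials and then, by density, for all \<open>v \<in> W5\<close>; with the differential equation
  this identifies \<open>c\<^sub>i\<close> with the coefficients of the series.  The remainders \<open>e\<^sub>n\<close> of the orthogonal
  expansion of \<open>u\<close> are Cauchy in \<open>W5\<close> by Bessel's inequality, so their derivatives up to order 4
  converge uniformly, say to those of \<open>E\<close>.  Since \<open>(L e\<^sub>n)(x\<^sub>j) = 0\<close> for \<open>j \<le> n\<close>, density of the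
  points gives \<open>L E = 0\<close>, and it remains to see that \<open>L\<close> is injective under the boundary conditions.
  For \<open>Re \<ge> 0\<close> this is an energy estimate, for \<open>Re \<le> 0\<close> a positivity argument for the
  \<open>2 \<times> 2\<close> minors of a pair of solutions.  Working with uniform limits of derivatives makes the
  completeness of \<open>W5\<close> unnecessary.
\<close>

section \<open>Absolutely continuous functions\<close>

text \<open>Let \<open>h x = exp x / exp 1 * (x^3 - 4 * x^2 + 4 * x)\<close>. The lowest coefficient
  of L is \<open>R * h'''\<close>, and \<open>L u = M\<close> says that f = u + h solves f'''' + R f
  f''' - m^2 f'' = 0; L is the linearization of this equation at h. If L v = 0, multiplying by v and
  integrating by parts makes the integral of v''^2 + m^2 v'^2 + R/2 (3 h' v'^2 + h''' v^2) vanish.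
  The bracket has a negative part, since h''' < 0 on the interval; its integral is nonnegative all
  the same, which helps only for R >= 0. For R < 0 the equation reads v'''' = p v''' + q v'' - k v
  with p, q, k >= 0, and this sign pattern is what keeps the minors nonnegative. Polynomials enter
  because L lowers the order by four: for a general v in \<open>W5\<close> the image L v is not in
  \<open>W4\<close>, so the adjoint relation says nothing about v directly. L sends polynomials to
  smooth functions, but the approximating polynomials must satisfy the boundary conditions of
  \<open>W5\<close> themselves.\<close>

lemma abs_continuous_ftc:
  assumes ac: "abs_continuous_on {a..b} f" and "a \<le> b" and E: "negligible E"
    and der: "\<And>x. x \<in> {a..b} - E \<Longrightarrow> (f has_vector_derivative f' x) (at x within {a..b})"
  shows "(f' has_integral (f b - f a)) {a..b}"
proof -
  \<comment> \<open>The proof estimates Henstock sums. With integrand 0 on \<open>E\<close>, a tag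
    in \<open>E\<close> contributes only the increment of \<open>f\<close> over its interval; a fine
    gauge keeps these intervals inside an open set of small measure, so absolute continuity bounds
    the total. The other tags use the definition of the derivative.\<close>
  define g where "g x = (if x \<in> E then 0 else f' x)" for x
  have "(g has_integral (f b - f a)) {a..b}"
    unfolding has_integral_real
  proof (intro allI impI)
    fix e :: real assume "e > 0"
    \<comment> \<open>The \<open>+ 1\<close> keeps the denominator positive when
      \<open>a = b\<close>. One half of \<open>e\<close> is spent on the tags outside
      \<open>E\<close>, the other on those inside.\<close>
    define e' where "e' = e / (2 * (b - a + 1))"
    have e': "e' > 0" "e' * (b - a) \<le> e / 2"
      using \<open>e > 0\<close> \<open>a \<le> b\<close> by (auto simp: e'_def divide_simps)
    obtain \<delta> where "\<delta> > 0" and \<delta>: "\<And>(n::nat) l r. \<lbrakk>\<And>i. i < n \<Longrightarrow> l i \<le> r i \<and> {l i..r i} \<subseteq> {a..b};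
        disjoint_family_on (\<lambda>i. {l i<..<r i}) {..<n}; (\<Sum>i<n. r i - l i) < \<delta>\<rbrakk>
        \<Longrightarrow> (\<Sum>i<n. \<bar>f (r i) - f (l i)\<bar>) < e / 2"
      using ac[unfolded abs_continuous_on_def, rule_format, of "e / 2"] \<open>e > 0\<close> by auto
    have Eleb: "E \<in> sets lebesgue" using E by (simp add: negligible_imp_sets)
    obtain U where U: "open U" "E \<subseteq> U" "U - E \<in> lmeasurable" "emeasure lebesgue (U - E) < ennreal \<delta>"
      using sets_lebesgue_outer_open[OF Eleb \<open>\<delta> > 0\<close>] by blast
    have Um: "U \<in> lmeasurable"
      using U E negligible_imp_measurable by (metis Diff_partition fmeasurable.Un)
    have "measure lebesgue U = measure lebesgue (U - E)"
      using E U by (metis measure_Diff_null_set negligible_iff_null_sets Um fmeasurableD)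
    then have mU: "measure lebesgue U < \<delta>"
      using U \<open>\<delta> > 0\<close> by (simp add: emeasure_eq_measure2 ennreal_less_iff)
    have "\<exists>d>0. (x \<in> {a..b} - E \<longrightarrow> (\<forall>y\<in>{a..b}. norm (y-x) < d \<longrightarrow>
             norm (f y - f x - (y-x) *\<^sub>R f' x) \<le> e' * norm (y-x))) \<and> (x \<in> E \<longrightarrow> ball x d \<subseteq> U)" for x
    proof (cases "x \<in> {a..b} - E")
      case True
      obtain d where "d > 0" "\<forall>y\<in>{a..b}. norm (y-x) < d \<longrightarrow>
             norm (f y - f x - (y-x) *\<^sub>R f' x) \<le> e' * norm (y-x)"
        using der[OF True, unfolded has_vector_derivative_def has_derivative_within_alt] e'(1) by blast
      with True show ?thesis by (intro exI[of _ d]) simp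
    next
      case False
      obtain d where "d > 0" "x \<in> E \<Longrightarrow> ball x d \<subseteq> U"
        using U openE by (metis subsetD zero_less_one)
      with False show ?thesis by blast
    qed
    then obtain d where d0: "\<And>x. d x > 0 \<and> (x \<in> {a..b} - E \<longrightarrow> (\<forall>y\<in>{a..b}. norm (y-x) < d x \<longrightarrow>
             norm (f y - f x - (y-x) *\<^sub>R f' x) \<le> e' * norm (y-x))) \<and> (x \<in> E \<longrightarrow> ball x (d x) \<subseteq> U)"
      using choice[of "\<lambda>x d. d > 0 \<and> (x \<in> {a..b} - E \<longrightarrow> (\<forall>y\<in>{a..b}. norm (y-x) < d \<longrightarrow>
             norm (f y - f x - (y-x) *\<^sub>R f' x) \<le> e' * norm (y-x))) \<and> (x \<in> E \<longrightarrow> ball x d \<subseteq> U)"] by blast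
    have d: "\<And>x. 0 < d x"
        "\<And>x y. \<lbrakk>x \<in> {a..b} - E; y \<in> {a..b}; norm (y-x) < d x\<rbrakk>
             \<Longrightarrow> norm (f y - f x - (y-x) *\<^sub>R f' x) \<le> e' * norm (y-x)"
        "\<And>x. x \<in> E \<Longrightarrow> ball x (d x) \<subseteq> U"
      using d0 by blast+
    show "\<exists>\<gamma>. gauge \<gamma> \<and> (\<forall>p. p tagged_division_of {a..b} \<and> \<gamma> fine p \<longrightarrow>
           norm ((\<Sum>(x, k)\<in>p. measure lborel k *\<^sub>R g x) - (f b - f a)) < e)"
    proof (rule exI, safe)
      show "gauge (\<lambda>x. ball x (d x))" using d(1) gauge_ball_dependent by blast
      fix p assume p: "p tagged_division_of {a..b}" and fine: "(\<lambda>x. ball x (d x)) fine p"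
      have finp: "finite p" using p by blast
      have K: "Inf K \<le> Sup K \<and> K = {Inf K..Sup K} \<and> x \<in> K \<and> K \<subseteq> {a..b} \<and> K \<subseteq> ball x (d x)"
        if xK: "(x, K) \<in> p" for x K
      proof -
        have "x \<in> K" "K \<subseteq> {a..b}" "\<exists>u v. K = cbox u v"
          using tagged_division_ofD(2-4)[OF p xK] by auto
        then obtain u v where "K = cbox u v" "x \<in> K" "K \<subseteq> {a..b}" by blast
        moreover have "K \<subseteq> ball x (d x)" using fine xK by (auto simp: fine_def)
        moreover have "u \<le> v" using calculation by auto
        ultimately show ?thesis by auto
      qed
      have ba: "b - a = (\<Sum>(x,K)\<in>p. Sup K - Inf K)" "f b - f a = (\<Sum>(x,K)\<in>p. f(Sup K) - f(Inf K))"
        using additive_tagged_division_1[where f= "\<lambda>x. x"] additive_tagged_division_1[where f= f]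
          \<open>a \<le> b\<close> p by auto
      \<comment> \<open>The intervals tagged in \<open>E\<close> get enumerated, because absolute
        continuity is stated for finite sequences of intervals.\<close>
      define q where "q = {z \<in> p. fst z \<in> E}"
      have "finite q" "q \<subseteq> p" using finp by (auto simp: q_def)
      obtain h where h: "bij_betw h {..<card q} q"
        using ex_bij_betw_nat_finite[OF \<open>finite q\<close>] by (auto simp: lessThan_atLeast0)
      define l r where "l i = Inf (snd (h i))" and "r i = Sup (snd (h i))" for i
      have hq: "h i \<in> q" "h i \<in> p" if "i < card q" for i
        using bij_betwE[OF h] \<open>q \<subseteq> p\<close> that by auto
      have lr: "l i \<le> r i \<and> {l i..r i} \<subseteq> {a..b} \<and> {l i..r i} = snd (h i) \<and> {l i..r i} \<subseteq> U"
        if "i < card q" for i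
      proof -
        have "(fst (h i), snd (h i)) \<in> p" "fst (h i) \<in> E" using hq[OF that] by (auto simp: q_def)
        then show ?thesis using K[of "fst (h i)" "snd (h i)"] d(3)[of "fst (h i)"]
          by (auto simp: l_def r_def)
      qed
      have disj: "disjoint_family_on (\<lambda>i. {l i<..<r i}) {..<card q}"
        unfolding disjoint_family_on_def
      proof (intro ballI impI)
        fix i j assume ij: "i \<in> {..<card q}" "j \<in> {..<card q}" "i \<noteq> j"
        then have "h i \<noteq> h j" using h by (auto simp: bij_betw_def inj_on_def)
        then have "interior (snd (h i)) \<inter> interior (snd (h j)) = {}"
          using tagged_division_ofD(5)[OF p, of "fst (h i)" "snd (h i)" "fst (h j)" "snd (h j)"] hq ij
          by auto
        moreover have "snd (h i) = {l i..r i}" "snd (h j) = {l j..r j}" using lr ij by auto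
        ultimately show "{l i<..<r i} \<inter> {l j<..<r j} = {}" by (metis interior_atLeastAtMost_real)
      qed
      have "(\<Sum>i<card q. r i - l i) = (\<Sum>i<card q. measure lebesgue {l i<..<r i})"
        using lr by (intro sum.cong) auto
      also have "\<dots> = measure lebesgue (\<Union>i<card q. {l i<..<r i})"
        by (rule measure_finite_Union[symmetric]) (use disj lr in \<open>auto simp: emeasure_lborel_Ioo\<close>)
      also have "\<dots> \<le> measure lebesgue U"
      proof (rule measure_mono_fmeasurable[OF _ _ Um])
        show "(\<Union>i<card q. {l i<..<r i}) \<subseteq> U"
          using lr greaterThanLessThan_subseteq_atLeastAtMost_iff by fastforce
      qed auto
      finally have "(\<Sum>i<card q. r i - l i) < \<delta>" using mU by simp
      then have "(\<Sum>i<card q. \<bar>f (r i) - f (l i)\<bar>) < e / 2"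
        by (intro \<delta>) (use lr disj in blast)+
      also have "(\<Sum>i<card q. \<bar>f (r i) - f (l i)\<bar>) = (\<Sum>z\<in>q. \<bar>f (Sup (snd z)) - f (Inf (snd z))\<bar>)"
        unfolding l_def r_def by (rule sum.reindex_bij_betw[OF h, of "\<lambda>z. \<bar>f (Sup (snd z)) - f (Inf (snd z))\<bar>"])
      finally have qsum: "(\<Sum>z\<in>q. \<bar>f (Sup (snd z)) - f (Inf (snd z))\<bar>) < e / 2" .
      have "norm (\<Sum>(x, K) \<in> p. (measure lborel K *\<^sub>R g x) - (f (Sup K) - f (Inf K)))
          \<le> (\<Sum>z\<in>p. e' * (Sup (snd z) - Inf (snd z)) + (if fst z \<in> E then \<bar>f (Sup (snd z)) - f (Inf (snd z))\<bar> else 0))"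
      proof (rule sum_norm_le, safe)
        fix x K assume xK: "(x, K) \<in> p"
        define u v where "u = Inf K" and "v = Sup K"
        have uv: "u \<le> v" "K = {u..v}" "x \<in> K" "K \<subseteq> {a..b}" "K \<subseteq> ball x (d x)"
          using K[OF xK] by (auto simp: u_def v_def)
        have "norm (measure lborel K *\<^sub>R g x - (f v - f u)) \<le> e' * (v - u) + (if x \<in> E then \<bar>f v - f u\<bar> else 0)"
        proof (cases "x \<in> E")
          case True then show ?thesis using e'(1) uv(1) by (simp add: g_def abs_minus_commute)
        next
          case False
          have uvK: "u \<in> K" "v \<in> K" using uv by auto
          have "norm ((v - u) *\<^sub>R f' x - (f v - f u)) = norm (f u - f x - (u - x) *\<^sub>R f' x - (f v - f x - (v - x) *\<^sub>R f' x))"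
            by (auto simp: algebra_simps)
          also have "\<dots> \<le> norm (f u - f x - (u - x) *\<^sub>R f' x) + norm (f v - f x - (v - x) *\<^sub>R f' x)"
            by (rule norm_triangle_ineq4)
          also have "\<dots> \<le> e' * norm (u - x) + e' * norm (v - x)"
          proof (intro add_mono d(2))
            have "u \<in> ball x (d x)" "v \<in> ball x (d x)" using uvK uv(5) by blast+
            then show "norm (u - x) < d x" "norm (v - x) < d x"
              by (simp_all add: dist_real_def abs_minus_commute)
          qed (use False uv uvK in auto)
          also have "\<dots> \<le> e' * (v - u)"
            using uv by (auto simp: algebra_simps)
          finally show ?thesis using False uv by (simp add: g_def)
        qed
        then show "norm (measure lborel K *\<^sub>R g x - (f (Sup K) - f (Inf K)))
          \<le> e' * (Sup (snd (x, K)) - Inf (snd (x, K)))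
             + (if fst (x, K) \<in> E then \<bar>f (Sup (snd (x, K))) - f (Inf (snd (x, K)))\<bar> else 0)"
          unfolding u_def v_def fst_conv snd_conv .
      qed
      also have "\<dots> = e' * (b - a) + (\<Sum>z\<in>q. \<bar>f (Sup (snd z)) - f (Inf (snd z))\<bar>)"
        using finp by (simp add: sum.distrib ba(1) split_def sum_distrib_left q_def sum.inter_filter)
      also have "\<dots> < e" using qsum e'(2) by simp
      finally show "norm ((\<Sum>(x, K)\<in>p. measure lborel K *\<^sub>R g x) - (f b - f a)) < e"
        by (simp add: ba(2) split_def sum_subtractf)
    qed
  qed
  then show ?thesis
    by (rule has_integral_spike[OF E, rotated]) (simp add: g_def)
qed

section \<open>The Sobolev spaces\<close>

lemma AE_lebesgue_on_iff_negligible: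
  assumes "S \<in> sets lebesgue"
  shows "(AE x in lebesgue_on S. P x) \<longleftrightarrow> (\<exists>N. negligible N \<and> (\<forall>x\<in>S - N. P x))"
proof
  assume "AE x in lebesgue_on S. P x"
  then obtain N where "N \<in> null_sets (lebesgue_on S)" "{x \<in> S. \<not> P x} \<subseteq> N"
    by (auto simp: eventually_ae_filter)
  then show "\<exists>N. negligible N \<and> (\<forall>x\<in>S - N. P x)"
    using assms by (intro exI[of _ N]) (auto simp: null_sets_restrict_space negligible_iff_null_sets)
next
  assume "\<exists>N. negligible N \<and> (\<forall>x\<in>S - N. P x)"
  then obtain N where N: "negligible N" "\<forall>x\<in>S - N. P x" by blast
  then have "N \<inter> S \<in> null_sets (lebesgue_on S)"
    using assms by (auto simp: null_sets_restrict_space negligible_iff_null_sets[symmetric] intro: negligible_Int)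
  then show "AE x in lebesgue_on S. P x"
    using N by (auto simp: eventually_ae_filter intro!: bexI[of _ "N \<inter> S"])
qed

section \<open>One-sided derivatives and their iterates\<close>

lemma D_eqI:
  assumes "(f has_real_derivative f') (at x within {0..1})" "x \<in> {0..1}"
  shows "D f x = f'"
  using vector_derivative_within_cbox[of 0 1 x f f'] assms
  by (simp add: D_def has_real_derivative_iff_has_vector_derivative)

lemma D_has_real_derivative:
  assumes "f differentiable (at x within {0..1})"
  shows "(f has_real_derivative D f x) (at x within {0..1})"
  using assms by (simp add: D_def has_real_derivative_iff_has_vector_derivative vector_derivative_works)

lemma has_real_derivative_cong01:
  assumes "\<And>x. x \<in> {0..1} \<Longrightarrow> f x = g x" "x \<in> {0..1}"
  shows "(f has_real_derivative d) (at x within {0..1}) \<longleftrightarrow> (g has_real_derivative d) (at x within {0..1})"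
  unfolding has_real_derivative_iff_has_vector_derivative
  using assms by (intro has_vector_derivative_cong_ev always_eventually) auto

lemma D_cong:
  assumes "\<And>x. x \<in> {0..1} \<Longrightarrow> f x = g x" "x \<in> {0..1}"
  shows "D f x = D g x"
  unfolding D_def vector_derivative_def has_real_derivative_iff_has_vector_derivative[symmetric]
  using has_real_derivative_cong01[OF assms] by simp

text \<open>A tower \<open>F\<close> of successive derivatives identifies the iterates of
  \<open>D\<close>. As \<open>(D ^^ k) f\<close> and \<open>F k\<close> agree on
  \<open>{0..1}\<close> only, each step exchanges them under \<open>D\<close> by
  \<open>D_cong\<close>.\<close>

lemma D_iter_eqI:
  assumes "\<And>x. x \<in> {0..1} \<Longrightarrow> F 0 x = f x"
    and "\<And>k x. k < n \<Longrightarrow> x \<in> {0..1} \<Longrightarrow> (F k has_real_derivative F (Suc k) x) (at x within {0..1})"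
    and "k \<le> n" "x \<in> {0..1}"
  shows "(D ^^ k) f x = F k x"
  using assms(3,4)
proof (induction k arbitrary: x)
  case (Suc k)
  have "D ((D ^^ k) f) x = D (F k) x" using Suc by (intro D_cong) auto
  also have "\<dots> = F (Suc k) x" using Suc assms(2) by (intro D_eqI) auto
  finally show ?case by simp
qed (use assms in auto)

section \<open>Stability of absolute continuity and square integrability\<close>

lemma abs_continuous_on_lincomb:
  assumes f: "abs_continuous_on S f" and g: "abs_continuous_on S g"
    and w: "\<And>x. x \<in> S \<Longrightarrow> w x = a * f x + b * g x"
  shows "abs_continuous_on S w"
  unfolding abs_continuous_on_def
proof (intro allI impI)
  fix e :: real assume "e > 0"
  \<comment> \<open>The summand 1 makes \<open>c\<close> positive even for \<open>a = b = 0\<close>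
    and leaves the slack \<open>e / c\<close> for the strict inequality.\<close>
  define c where "c = \<bar>a\<bar> + \<bar>b\<bar> + 1"
  have "c > 0" by (simp add: c_def add_nonneg_pos)
  then have "e / c > 0" using \<open>e > 0\<close> by simp
  obtain d1 where d1: "d1 > 0" "\<forall>(n::nat) l r. (\<forall>i<n. l i \<le> r i \<and> {l i..r i} \<subseteq> S) \<and>
        disjoint_family_on (\<lambda>i. {l i<..<r i}) {..<n} \<and> (\<Sum>i<n. r i - l i) < d1 \<longrightarrow>
        (\<Sum>i<n. \<bar>f (r i) - f (l i)\<bar>) < e / c"
    using f \<open>e / c > 0\<close> unfolding abs_continuous_on_def by blast
  obtain d2 where d2: "d2 > 0" "\<forall>(n::nat) l r. (\<forall>i<n. l i \<le> r i \<and> {l i..r i} \<subseteq> S) \<and>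
        disjoint_family_on (\<lambda>i. {l i<..<r i}) {..<n} \<and> (\<Sum>i<n. r i - l i) < d2 \<longrightarrow>
        (\<Sum>i<n. \<bar>g (r i) - g (l i)\<bar>) < e / c"
    using g \<open>e / c > 0\<close> unfolding abs_continuous_on_def by blast
  show "\<exists>\<delta>>0. \<forall>(n::nat) l r. (\<forall>i<n. l i \<le> r i \<and> {l i..r i} \<subseteq> S) \<and>
        disjoint_family_on (\<lambda>i. {l i<..<r i}) {..<n} \<and> (\<Sum>i<n. r i - l i) < \<delta> \<longrightarrow>
        (\<Sum>i<n. \<bar>w (r i) - w (l i)\<bar>) < e"
  proof (rule exI[of _ "min d1 d2"], intro conjI allI impI)
    fix n :: nat and l r :: "nat \<Rightarrow> real"
    assume *: "(\<forall>i<n. l i \<le> r i \<and> {l i..r i} \<subseteq> S) \<and>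
        disjoint_family_on (\<lambda>i. {l i<..<r i}) {..<n} \<and> (\<Sum>i<n. r i - l i) < min d1 d2"
    then have 1: "(\<Sum>i<n. \<bar>f (r i) - f (l i)\<bar>) < e / c" and 2: "(\<Sum>i<n. \<bar>g (r i) - g (l i)\<bar>) < e / c"
      using d1(2) d2(2) by simp_all
    have "(\<Sum>i<n. \<bar>w (r i) - w (l i)\<bar>) \<le> (\<Sum>i<n. \<bar>a\<bar> * \<bar>f (r i) - f (l i)\<bar> + \<bar>b\<bar> * \<bar>g (r i) - g (l i)\<bar>)"
    proof (rule sum_mono)
      fix i assume "i \<in> {..<n}"
      then have "l i \<in> S" "r i \<in> S" using * by (auto simp: subset_iff)
      then have "w (r i) - w (l i) = a * (f (r i) - f (l i)) + b * (g (r i) - g (l i))"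
        by (simp add: w algebra_simps)
      then show "\<bar>w (r i) - w (l i)\<bar> \<le> \<bar>a\<bar> * \<bar>f (r i) - f (l i)\<bar> + \<bar>b\<bar> * \<bar>g (r i) - g (l i)\<bar>"
        by (metis abs_mult abs_triangle_ineq)
    qed
    also have "\<dots> = \<bar>a\<bar> * (\<Sum>i<n. \<bar>f (r i) - f (l i)\<bar>) + \<bar>b\<bar> * (\<Sum>i<n. \<bar>g (r i) - g (l i)\<bar>)"
      by (simp add: sum.distrib sum_distrib_left)
    also have "\<dots> \<le> \<bar>a\<bar> * (e / c) + \<bar>b\<bar> * (e / c)"
      using 1 2 by (intro add_mono mult_left_mono) auto
    also have "\<dots> = c * (e / c) - e / c" by (simp only: c_def distrib_right)
    also have "\<dots> < c * (e / c)" using \<open>e / c > 0\<close> by simp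
    finally show "(\<Sum>i<n. \<bar>w (r i) - w (l i)\<bar>) < e" using \<open>c > 0\<close> by simp
  qed (use d1 d2 in auto)
qed

lemma abs_continuous_on_subset:
  assumes "abs_continuous_on S f" "T \<subseteq> S"
  shows "abs_continuous_on T f"
  unfolding abs_continuous_on_def
proof (intro allI impI)
  fix e :: real assume "e > 0"
  then obtain d where d: "d > 0" "\<forall>(n::nat) l r. (\<forall>i<n. l i \<le> r i \<and> {l i..r i} \<subseteq> S) \<and>
        disjoint_family_on (\<lambda>i. {l i<..<r i}) {..<n} \<and> (\<Sum>i<n. r i - l i) < d \<longrightarrow>
        (\<Sum>i<n. \<bar>f (r i) - f (l i)\<bar>) < e"
    using assms(1) unfolding abs_continuous_on_def by blast
  show "\<exists>\<delta>>0. \<forall>(n::nat) l r. (\<forall>i<n. l i \<le> r i \<and> {l i..r i} \<subseteq> T) \<and>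
        disjoint_family_on (\<lambda>i. {l i<..<r i}) {..<n} \<and> (\<Sum>i<n. r i - l i) < \<delta> \<longrightarrow>
        (\<Sum>i<n. \<bar>f (r i) - f (l i)\<bar>) < e"
  proof (rule exI[of _ d], intro conjI allI impI)
    fix n :: nat and l r :: "nat \<Rightarrow> real"
    assume *: "(\<forall>i<n. l i \<le> r i \<and> {l i..r i} \<subseteq> T) \<and>
        disjoint_family_on (\<lambda>i. {l i<..<r i}) {..<n} \<and> (\<Sum>i<n. r i - l i) < d"
    then have "\<forall>i<n. l i \<le> r i \<and> {l i..r i} \<subseteq> S" using assms(2) by (meson order_trans)
    then show "(\<Sum>i<n. \<bar>f (r i) - f (l i)\<bar>) < e" using d(2) * by simp
  qed (rule d(1))
qed

lemma abs_continuous_on_lipschitz: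
  assumes "\<And>x y. x \<in> S \<Longrightarrow> y \<in> S \<Longrightarrow> \<bar>f x - f y\<bar> \<le> C * \<bar>x - y\<bar>" "C \<ge> 0"
  shows "abs_continuous_on S f"
  unfolding abs_continuous_on_def
proof (intro allI impI)
  fix e :: real assume "e > 0"
  show "\<exists>\<delta>>0. \<forall>(n::nat) l r. (\<forall>i<n. l i \<le> r i \<and> {l i..r i} \<subseteq> S) \<and>
        disjoint_family_on (\<lambda>i. {l i<..<r i}) {..<n} \<and> (\<Sum>i<n. r i - l i) < \<delta> \<longrightarrow>
        (\<Sum>i<n. \<bar>f (r i) - f (l i)\<bar>) < e"
  proof (rule exI[of _ "e / (C + 1)"], intro conjI allI impI)
    fix n :: nat and l r :: "nat \<Rightarrow> real"
    assume *: "(\<forall>i<n. l i \<le> r i \<and> {l i..r i} \<subseteq> S) \<and>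
        disjoint_family_on (\<lambda>i. {l i<..<r i}) {..<n} \<and> (\<Sum>i<n. r i - l i) < e / (C + 1)"
    have "(\<Sum>i<n. \<bar>f (r i) - f (l i)\<bar>) \<le> (\<Sum>i<n. C * (r i - l i))"
    proof (rule sum_mono)
      fix i assume "i \<in> {..<n}"
      then have "l i \<in> S" "r i \<in> S" "l i \<le> r i" using * by (auto simp: subset_iff)
      then show "\<bar>f (r i) - f (l i)\<bar> \<le> C * (r i - l i)" using assms(1)[of "r i" "l i"] by simp
    qed
    also have "\<dots> = C * (\<Sum>i<n. r i - l i)" by (simp add: sum_distrib_left)
    also have "\<dots> \<le> C * (e / (C + 1))" using * assms(2) by (intro mult_left_mono) auto
    also have "\<dots> < e" using assms(2) \<open>e > 0\<close> by (simp add: field_simps)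
    finally show "(\<Sum>i<n. \<bar>f (r i) - f (l i)\<bar>) < e" .
  qed (use assms(2) \<open>e > 0\<close> in auto)
qed

lemma borel_measurable_lebesgue_on_cong_AE:
  fixes f g :: "real \<Rightarrow> real"
  assumes "f \<in> borel_measurable (lebesgue_on S)" "S \<in> sets lebesgue" "AE x in lebesgue_on S. g x = f x"
  shows "g \<in> borel_measurable (lebesgue_on S)"
  using assms measurable_on_spike[of f S _ g]
  by (auto simp: AE_lebesgue_on_iff_negligible measurable_on_iff_borel_measurable[symmetric])

lemma square_integrable01_mult:
  assumes "square_integrable01 f" "square_integrable01 g"
  shows "integrable (lebesgue_on {0..1}) (\<lambda>x. f x * g x)"
proof (rule Bochner_Integration.integrable_bound)
  show "integrable (lebesgue_on {0..1}) (\<lambda>x. (f x)\<^sup>2 + (g x)\<^sup>2)"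
    using assms by (auto simp: square_integrable01_def)
  show "(\<lambda>x. f x * g x) \<in> borel_measurable (lebesgue_on {0..1})"
    using assms by (auto simp: square_integrable01_def)
  have "\<bar>a * b\<bar> \<le> a\<^sup>2 + b\<^sup>2" for a b :: real
  proof -
    have "0 \<le> \<bar>a\<bar> * \<bar>b\<bar>" by simp
    then show ?thesis using sum_squares_bound[of "\<bar>a\<bar>" "\<bar>b\<bar>"] unfolding abs_mult power2_abs by linarith
  qed
  then show "AE x in lebesgue_on {0..1}. norm (f x * g x) \<le> norm ((f x)\<^sup>2 + (g x)\<^sup>2)"
    by simp
qed

lemma square_integrable01_lincomb:
  assumes f: "square_integrable01 f" and g: "square_integrable01 g"
    and w: "AE x in lebesgue_on {0..1}. w x = a * f x + b * g x"
  shows "square_integrable01 w"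
proof -
  have [measurable]: "f \<in> borel_measurable (lebesgue_on {0..1})" "g \<in> borel_measurable (lebesgue_on {0..1})"
    using f g by (auto simp: square_integrable01_def)
  have wm: "w \<in> borel_measurable (lebesgue_on {0..1})"
    by (rule borel_measurable_lebesgue_on_cong_AE[OF _ _ w]) auto
  have "integrable (lebesgue_on {0..1}) (\<lambda>x. a\<^sup>2 * (f x)\<^sup>2 + (2 * a * b) * (f x * g x) + b\<^sup>2 * (g x)\<^sup>2)"
    using f g square_integrable01_mult[OF f g] by (auto simp: square_integrable01_def)
  then have "integrable (lebesgue_on {0..1}) (\<lambda>x. (w x)\<^sup>2)"
    by (rule integrable_cong_AE_imp) (use w wm in \<open>auto simp: power2_eq_square algebra_simps\<close>)
  then show ?thesis using wm by (simp add: square_integrable01_def)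
qed

section \<open>The Sobolev spaces as vector spaces\<close>

lemma sobolev_abs_continuous:
  "u \<in> sobolev n \<Longrightarrow> k < n \<Longrightarrow> abs_continuous_on {0..1} ((D ^^ k) u)"
  by (simp add: sobolev_def)

lemma sobolev_square_integrable: "u \<in> sobolev n \<Longrightarrow> square_integrable01 ((D ^^ n) u)"
  by (simp add: sobolev_def)

lemma sobolev_has_derivative:
  assumes "u \<in> sobolev n" "k < n - 1" "x \<in> {0..1}"
  shows "((D ^^ k) u has_real_derivative (D ^^ Suc k) u x) (at x within {0..1})"
  using D_has_real_derivative[of "(D ^^ k) u" x] assms by (simp add: sobolev_def differentiable_on_def)

lemma sobolev_AE_has_derivative:
  assumes "u \<in> sobolev n" "k < n"
  shows "AE x in lebesgue_on {0..1}. ((D ^^ k) u has_real_derivative (D ^^ Suc k) u x) (at x within {0..1})"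
proof (cases "k < n - 1")
  case True
  then show ?thesis using sobolev_has_derivative[OF assms(1)] by (intro AE_I2) auto
next
  case False
  then have "AE x in lebesgue_on {0..1}. (D ^^ k) u differentiable (at x within {0..1})"
  proof -
    have "k = n - 1" using False assms(2) by linarith
    then show ?thesis using assms(1) by (simp add: sobolev_def)
  qed
  then show ?thesis by eventually_elim (use D_has_real_derivative in auto)
qed

lemma DERIV_lincomb:
  fixes f g :: "real \<Rightarrow> real"
  assumes "(f has_real_derivative f') (at x within S)" "(g has_real_derivative g') (at x within S)"
  shows "((\<lambda>x. a * f x + b * g x) has_real_derivative a * f' + b * g') (at x within S)"
  by (intro DERIV_add DERIV_cmult assms)

lemma sobolev_D_iter_lincomb:
  assumes u: "u \<in> sobolev n" and v: "v \<in> sobolev n"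
    and w: "\<forall>x\<in>{0..1}. w x = a * u x + b * v x" and "k < n" "x \<in> {0..1}"
  shows "(D ^^ k) w x = a * (D ^^ k) u x + b * (D ^^ k) v x"
proof (rule D_iter_eqI[where n = "n - 1" and F = "\<lambda>k x. a * (D ^^ k) u x + b * (D ^^ k) v x"])
  show "((\<lambda>x. a * (D ^^ i) u x + b * (D ^^ i) v x) has_real_derivative
      a * (D ^^ Suc i) u y + b * (D ^^ Suc i) v y) (at y within {0..1})" if "i < n - 1" "y \<in> {0..1}" for i y
    by (intro DERIV_lincomb sobolev_has_derivative[OF u that] sobolev_has_derivative[OF v that])
  show "a * (D ^^ 0) u y + b * (D ^^ 0) v y = w y" if "y \<in> {0..1}" for y
    using w that by simp
  show "k \<le> n - 1" "x \<in> {0..1}" using assms(4,5) by auto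
qed

text \<open>Below the top order \<open>D\<close> is linear at every point; at order \<open>n\<close>
  only where both derivatives exist, since elsewhere \<open>D\<close> returns an unspecified value.
  The first conjunct gives differentiability of \<open>(D ^^ (n - 1)) w\<close>, the second square
  integrability of \<open>(D ^^ n) w\<close>.\<close>

lemma sobolev_AE_D_iter_lincomb:
  assumes u: "u \<in> sobolev n" and v: "v \<in> sobolev n" and "n > 0"
    and w: "\<forall>x\<in>{0..1}. w x = a * u x + b * v x"
  shows "AE x in lebesgue_on {0..1}. ((D ^^ (n - 1)) w has_real_derivative (a * (D ^^ n) u x + b * (D ^^ n) v x)) (at x within {0..1})
    \<and> (D ^^ n) w x = a * (D ^^ n) u x + b * (D ^^ n) v x"
proof -
  have n: "Suc (n - 1) = n" "n - 1 < n" using \<open>n > 0\<close> by auto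
  have "AE x in lebesgue_on {0..1}. x \<in> space (lebesgue_on {0..1})" by (rule AE_space)
  with sobolev_AE_has_derivative[OF u n(2)] sobolev_AE_has_derivative[OF v n(2)]
  show ?thesis
    unfolding n(1)
  proof eventually_elim
    case (elim x)
    then have x: "x \<in> {0..1}" by simp
    have "((\<lambda>x. a * (D ^^ (n - 1)) u x + b * (D ^^ (n - 1)) v x) has_real_derivative
        a * (D ^^ n) u x + b * (D ^^ n) v x) (at x within {0..1})"
      using elim by (intro DERIV_lincomb)
    then have *: "((D ^^ (n - 1)) w has_real_derivative a * (D ^^ n) u x + b * (D ^^ n) v x) (at x within {0..1})"
      using has_real_derivative_cong01[OF sobolev_D_iter_lincomb[OF u v w n(2)] x] by simp
    have "(D ^^ n) w x = D ((D ^^ (n - 1)) w) x"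
      by (subst n(1)[symmetric]) simp
    with * D_eqI[OF * x] show ?case by simp
  qed
qed

lemma sobolev_lincomb:
  assumes u: "u \<in> sobolev n" and v: "v \<in> sobolev n" and "n > 0"
    and w: "\<forall>x\<in>{0..1}. w x = a * u x + b * v x"
  shows "w \<in> sobolev n"
proof -
  note AE = sobolev_AE_D_iter_lincomb[OF u v \<open>n > 0\<close> w]
  have 1: "(D ^^ k) w differentiable (at x within {0..1})" if "k < n - 1" "x \<in> {0..1}" for k x
  proof -
    have "((\<lambda>x. a * (D ^^ k) u x + b * (D ^^ k) v x) has_real_derivative
        a * (D ^^ Suc k) u x + b * (D ^^ Suc k) v x) (at x within {0..1})"
      by (intro DERIV_lincomb sobolev_has_derivative[OF u that] sobolev_has_derivative[OF v that])
    then have "((D ^^ k) w has_real_derivative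
        a * (D ^^ Suc k) u x + b * (D ^^ Suc k) v x) (at x within {0..1})"
      using has_real_derivative_cong01[OF sobolev_D_iter_lincomb[OF u v w, of k] that(2)] that(1) by simp
    then show ?thesis using real_differentiable_def by blast
  qed
  have 2: "abs_continuous_on {0..1} ((D ^^ k) w)" if "k < n" for k
    by (rule abs_continuous_on_lincomb[OF sobolev_abs_continuous[OF u that] sobolev_abs_continuous[OF v that]
          sobolev_D_iter_lincomb[OF u v w that]])
  have 3: "AE x in lebesgue_on {0..1}. (D ^^ (n - 1)) w differentiable (at x within {0..1})"
    using AE by eventually_elim (use real_differentiable_def in blast)
  have 4: "square_integrable01 ((D ^^ n) w)"
    by (rule square_integrable01_lincomb[OF sobolev_square_integrable[OF u] sobolev_square_integrable[OF v]])
       (use AE in eventually_elim, simp)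
  show ?thesis using 1 2 3 4 by (auto simp: sobolev_def differentiable_on_def)
qed

section \<open>The inner product and pointwise bounds\<close>

lemma sobolev_inner_commute: "sobolev_inner n u v = sobolev_inner n v u"
  by (simp add: sobolev_inner_def mult.commute)

lemma sobolev_inner_lincomb:
  assumes u: "u \<in> sobolev n" and v: "v \<in> sobolev n" and z: "z \<in> sobolev n" and "n > 0"
    and w: "\<forall>x\<in>{0..1}. w x = a * u x + b * v x"
  shows "sobolev_inner n w z = a * sobolev_inner n u z + b * sobolev_inner n v z"
proof -
  note m = sobolev_square_integrable[OF u] sobolev_square_integrable[OF v] sobolev_square_integrable[OF z]
    sobolev_square_integrable[OF sobolev_lincomb[OF u v \<open>n > 0\<close> w]]
  have "integral\<^sup>L (lebesgue_on {0..1}) (\<lambda>x. (D ^^ n) w x * (D ^^ n) z x)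
      = integral\<^sup>L (lebesgue_on {0..1}) (\<lambda>x. a * ((D ^^ n) u x * (D ^^ n) z x) + b * ((D ^^ n) v x * (D ^^ n) z x))"
  proof (rule integral_cong_AE)
    show "AE x in lebesgue_on {0..1}. (D ^^ n) w x * (D ^^ n) z x
        = a * ((D ^^ n) u x * (D ^^ n) z x) + b * ((D ^^ n) v x * (D ^^ n) z x)"
      using sobolev_AE_D_iter_lincomb[OF u v \<open>n > 0\<close> w] by eventually_elim (simp add: algebra_simps)
  qed (use m in \<open>auto simp: square_integrable01_def\<close>)
  also have "\<dots> = a * integral\<^sup>L (lebesgue_on {0..1}) (\<lambda>x. (D ^^ n) u x * (D ^^ n) z x)
      + b * integral\<^sup>L (lebesgue_on {0..1}) (\<lambda>x. (D ^^ n) v x * (D ^^ n) z x)"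
    using m by (simp add: square_integrable01_mult)
  finally show ?thesis
    using sobolev_D_iter_lincomb[OF u v w]
    by (simp add: sobolev_inner_def algebra_simps sum.distrib sum_distrib_left)
qed

lemma sobolev_inner_nonneg: "sobolev_inner n u u \<ge> 0"
  by (simp add: sobolev_inner_def sum_nonneg)

text \<open>The squared norm of \<open>s * u + t * v\<close> is a nonnegative quadratic form in
  \<open>s\<close> and \<open>t\<close>. On functions of type \<open>real \<Rightarrow> real\<close>
  the inner product is only semidefinite, as values outside \<open>{0..1}\<close> do not count;
  hence the separate case \<open>C = 0\<close>.\<close>

lemma sobolev_inner_cauchy_schwarz:
  assumes u: "u \<in> sobolev n" and v: "v \<in> sobolev n" and "n > 0"
  shows "(sobolev_inner n u v)\<^sup>2 \<le> sobolev_inner n u u * sobolev_inner n v v"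
proof -
  define A B C where "A = sobolev_inner n u u" and "B = sobolev_inner n u v" and "C = sobolev_inner n v v"
  have q: "0 \<le> s\<^sup>2 * A + 2 * s * t * B + t\<^sup>2 * C" for s t
  proof -
    define w where "w x = s * u x + t * v x" for x
    have w: "\<forall>x\<in>{0..1}. w x = s * u x + t * v x" by (simp add: w_def)
    note wS = sobolev_lincomb[OF u v \<open>n > 0\<close> w]
    have "sobolev_inner n w w = s * sobolev_inner n u w + t * sobolev_inner n v w"
      by (rule sobolev_inner_lincomb[OF u v wS \<open>n > 0\<close> w])
    also have "sobolev_inner n u w = s * A + t * B"
      using sobolev_inner_lincomb[OF u v u \<open>n > 0\<close> w] by (simp add: sobolev_inner_commute A_def B_def)
    also have "sobolev_inner n v w = s * B + t * C"
      using sobolev_inner_lincomb[OF u v v \<open>n > 0\<close> w] by (simp add: sobolev_inner_commute B_def C_def)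
    finally show ?thesis using sobolev_inner_nonneg[of n w]
      by (simp add: power2_eq_square algebra_simps)
  qed
  have "A \<ge> 0" "C \<ge> 0" by (simp_all add: A_def C_def sobolev_inner_nonneg)
  have "B\<^sup>2 \<le> A * C"
  proof (cases "C = 0")
    case True
    have "B = 0"
    proof (rule ccontr)
      assume "B \<noteq> 0"
      \<comment> \<open>For \<open>C = 0\<close> and \<open>s = 1\<close> the form is
        \<open>A + 2 * t * B\<close>, and this \<open>t\<close> gives it the value -1.\<close>
      then show False using q[of 1 "- (A + 1) / (2 * B)"] True by (simp add: field_simps)
    qed
    then show ?thesis using True by simp
  next
    case False
    then have "C > 0" using \<open>C \<ge> 0\<close> by simp
    have "0 \<le> C * (A * C - B\<^sup>2)" using q[of C "- B"] by (simp add: power2_eq_square algebra_simps)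
    then show ?thesis using \<open>C > 0\<close> by (simp add: zero_le_mult_iff)
  qed
  then show ?thesis by (simp add: A_def B_def C_def)
qed

text \<open>The variance of \<open>\<bar>f\<bar>\<close> is nonnegative; the interval has measure 1,
  so \<open>I\<close> is the mean.\<close>

lemma integral_abs_le_L2_norm:
  assumes "square_integrable01 f"
  shows "integral\<^sup>L (lebesgue_on {0..1}) (\<lambda>x. \<bar>f x\<bar>) \<le> sqrt (integral\<^sup>L (lebesgue_on {0..1}) (\<lambda>x. (f x)\<^sup>2))"
proof -
  define I where "I = integral\<^sup>L (lebesgue_on {0..1}) (\<lambda>x. \<bar>f x\<bar>)"
  have one: "square_integrable01 (\<lambda>_. 1)" by (auto simp: square_integrable01_def)
  have f: "integrable (lebesgue_on {0..1}) (\<lambda>x. (f x)\<^sup>2)" "integrable (lebesgue_on {0..1}) f"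
    using assms square_integrable01_mult[OF assms one] by (auto simp: square_integrable01_def)
  have "0 \<le> integral\<^sup>L (lebesgue_on {0..1}) (\<lambda>x. (\<bar>f x\<bar> - I)\<^sup>2)" by simp
  also have "\<dots> = integral\<^sup>L (lebesgue_on {0..1}) (\<lambda>x. (f x)\<^sup>2 - 2 * I * \<bar>f x\<bar> + I\<^sup>2)"
    by (simp add: power2_diff algebra_simps)
  also have "\<dots> = integral\<^sup>L (lebesgue_on {0..1}) (\<lambda>x. (f x)\<^sup>2) - I\<^sup>2"
    using f by (simp add: I_def[symmetric] measure_restrict_space power2_eq_square)
  finally show ?thesis using real_le_rsqrt by (simp add: I_def)
qed

text \<open>The norm \<open>N\<close> bounds every initial value at 0 and the L2 norm of the top
  derivative. Integrating the latter gives \<open>2 * N\<close> at order \<open>m\<close>; each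
  further integration adds one initial value, hence one more \<open>N\<close>, and order 0 ends at
  \<open>m + 2\<close>.\<close>

lemma sobolev_embedding:
  assumes u: "u \<in> sobolev (Suc m)" and "k \<le> m" "x \<in> {0..1}"
  shows "\<bar>(D ^^ k) u x\<bar> \<le> (real m + 2) * sqrt (sobolev_inner (Suc m) u u)"
proof -
  define N where "N = sqrt (sobolev_inner (Suc m) u u)"
  have "N \<ge> 0" by (simp add: N_def sobolev_inner_nonneg)
  note sq = sobolev_square_integrable[OF u]
  have int0: "0 \<le> integral\<^sup>L (lebesgue_on {0..1}) (\<lambda>x. ((D ^^ Suc m) u x)\<^sup>2)" by simp
  have ini: "\<bar>(D ^^ i) u 0\<bar> \<le> N" if "i \<le> m" for i
  proof -
    have "((D ^^ i) u 0)\<^sup>2 \<le> (\<Sum>i<Suc m. ((D ^^ i) u 0)\<^sup>2)"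
      by (rule member_le_sum) (use that in auto)
    also have "\<dots> \<le> sobolev_inner (Suc m) u u" using int0 by (simp add: sobolev_inner_def power2_eq_square)
    finally show ?thesis by (metis N_def real_le_rsqrt power2_abs)
  qed
  have L2: "sqrt (integral\<^sup>L (lebesgue_on {0..1}) (\<lambda>x. ((D ^^ Suc m) u x)\<^sup>2)) \<le> N"
    unfolding N_def sobolev_inner_def
    by (rule real_sqrt_le_mono) (simp add: power2_eq_square sum_nonneg)
  have top: "\<bar>(D ^^ m) u x\<bar> \<le> 2 * N" if x: "x \<in> {0..1}" for x
  proof -
    obtain E where E: "negligible E" "\<And>x. x \<in> {0..1} - E \<Longrightarrow>
        ((D ^^ m) u has_real_derivative (D ^^ Suc m) u x) (at x within {0..1})"
      using sobolev_AE_has_derivative[OF u, of m] by (auto simp: AE_lebesgue_on_iff_negligible)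
    have ac: "abs_continuous_on {0..x} ((D ^^ m) u)"
      by (rule abs_continuous_on_subset[OF sobolev_abs_continuous[OF u]]) (use x in auto)
    have one: "square_integrable01 (\<lambda>_. 1)" by (auto simp: square_integrable01_def)
    have i1: "integrable (lebesgue_on {0..1}) ((D ^^ Suc m) u)"
      using square_integrable01_mult[OF sq one] by simp
    have "((D ^^ Suc m) u has_integral ((D ^^ m) u x - (D ^^ m) u 0)) {0..x}"
      by (rule abs_continuous_ftc[OF ac _ E(1)])
         (use E(2) x in \<open>auto simp: has_real_derivative_iff_has_vector_derivative
            intro: has_vector_derivative_within_subset[of _ _ _ "{0..1}"]\<close>)
    then have eq: "(D ^^ m) u x - (D ^^ m) u 0 = integral {0..x} ((D ^^ Suc m) u)"
      and io: "(D ^^ Suc m) u integrable_on {0..x}"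
      by (auto simp: integral_unique)
    have abs1: "(\<lambda>x. \<bar>(D ^^ Suc m) u x\<bar>) integrable_on {0..1}"
      using i1 by (intro integrable_on_lebesgue_on) auto
    have "\<bar>integral {0..x} ((D ^^ Suc m) u)\<bar> \<le> integral {0..x} (\<lambda>x. \<bar>(D ^^ Suc m) u x\<bar>)"
      using integral_norm_bound_integral[OF io integrable_on_subinterval[OF abs1]] x by auto
    also have "\<dots> \<le> integral {0..1} (\<lambda>x. \<bar>(D ^^ Suc m) u x\<bar>)"
      using x by (intro integral_subset_le integrable_on_subinterval[OF abs1] abs1) auto
    also have "\<dots> = integral\<^sup>L (lebesgue_on {0..1}) (\<lambda>x. \<bar>(D ^^ Suc m) u x\<bar>)"
      using i1 by (intro lebesgue_integral_eq_integral[symmetric]) auto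
    also have "\<dots> \<le> N" using integral_abs_le_L2_norm[OF sq] L2 by linarith
    finally show ?thesis using eq ini[of m] by linarith
  qed
  have "\<bar>(D ^^ (m - j)) u x\<bar> \<le> (2 + real j) * N" if "x \<in> {0..1}" "j \<le> m" for j x
    using that
  proof (induction j arbitrary: x)
    case 0 then show ?case using top by simp
  next
    case (Suc j)
    have s: "Suc (m - Suc j) = m - j" "m - Suc j < Suc m - 1" using Suc by auto
    have "norm ((D ^^ (m - Suc j)) u x - (D ^^ (m - Suc j)) u 0) \<le> ((2 + real j) * N) * norm (x - 0)"
      by (rule field_differentiable_bound[of "{0..1}" _ "(D ^^ (m - j)) u"])
         (use Suc sobolev_has_derivative[OF u s(2)] s(1) in auto)
    also have "\<dots> \<le> (2 + real j) * N"
      using Suc \<open>N \<ge> 0\<close> by (simp add: mult_left_le)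
    finally show ?case using ini[of "m - Suc j"] by (simp add: algebra_simps)
  qed
  from this[of x "m - k"] assms have "\<bar>(D ^^ k) u x\<bar> \<le> (2 + real (m - k)) * N" by simp
  also have "\<dots> \<le> (real m + 2) * N" using \<open>N \<ge> 0\<close> by (intro mult_right_mono) auto
  finally show ?thesis by (simp add: N_def)
qed

section \<open>Density of polynomials\<close>

lemma square_integrable01_continuous:
  assumes "continuous_on {0..1} f"
  shows "square_integrable01 f"
  unfolding square_integrable01_def
  by (intro conjI continuous_imp_measurable_on_sets_lebesgue continuous_imp_integrable_real
        continuous_intros assms) auto

text \<open>From \<open>(a + b)^2 \<le> 2 * a^2 + 2 * b^2\<close>. The factors 2 explain the
  tolerances \<open>e / 4\<close> in the two approximation lemmas that follow.\<close>

lemma L2_dist_triangle: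
  assumes "square_integrable01 f" "square_integrable01 g" "square_integrable01 h"
  shows "integral\<^sup>L (lebesgue_on {0..1}) (\<lambda>x. (f x - h x)\<^sup>2)
    \<le> 2 * integral\<^sup>L (lebesgue_on {0..1}) (\<lambda>x. (f x - g x)\<^sup>2) + 2 * integral\<^sup>L (lebesgue_on {0..1}) (\<lambda>x. (g x - h x)\<^sup>2)"
proof -
  have int: "integrable (lebesgue_on {0..1}) (\<lambda>x. (a x - b x)\<^sup>2)"
    if "square_integrable01 a" "square_integrable01 b" for a b
    using square_integrable01_lincomb[OF that, of "\<lambda>x. a x - b x" 1 "-1"] by (simp add: square_integrable01_def)
  have "integral\<^sup>L (lebesgue_on {0..1}) (\<lambda>x. (f x - h x)\<^sup>2)
      \<le> integral\<^sup>L (lebesgue_on {0..1}) (\<lambda>x. 2 * (f x - g x)\<^sup>2 + 2 * (g x - h x)\<^sup>2)"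
  proof (rule integral_mono)
    fix x
    have "0 \<le> ((f x - g x) - (g x - h x))\<^sup>2" by simp
    then show "(f x - h x)\<^sup>2 \<le> 2 * (f x - g x)\<^sup>2 + 2 * (g x - h x)\<^sup>2"
      by (simp add: power2_eq_square algebra_simps)
  qed (use int assms in auto)
  then show ?thesis using int assms by simp
qed

definition clamp_real :: "real \<Rightarrow> real \<Rightarrow> real" where
  "clamp_real N y = max (- N) (min N y)"

text \<open>Truncation at a large height \<open>N\<close> changes \<open>g\<close> little in L2, by
  dominated convergence. The continuous functions converging to \<open>g\<close> almost everywhere
  are then truncated at the same height, so that the constant \<open>(2 * real N)^2\<close>
  dominates the second limit.\<close>

lemma continuous_dense_L2:
  assumes g: "square_integrable01 g" and "e > 0"
  obtains h where "continuous_on {0..1} h"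
    "integral\<^sup>L (lebesgue_on {0..1}) (\<lambda>x. (g x - h x)\<^sup>2) < e"
proof -
  have [measurable]: "g \<in> borel_measurable (lebesgue_on {0..1})"
    using g by (simp add: square_integrable01_def)
  have ig: "integrable (lebesgue_on {0..1}) (\<lambda>x. (g x)\<^sup>2)"
    using g by (simp add: square_integrable01_def)
  have [measurable]: "clamp_real N \<in> borel_measurable borel" for N
    unfolding clamp_real_def by measurable
  have "(\<lambda>n. integral\<^sup>L (lebesgue_on {0..1}) (\<lambda>x. (g x - clamp_real (real n) (g x))\<^sup>2))
      \<longlonglongrightarrow> integral\<^sup>L (lebesgue_on {0..1}) (\<lambda>x::real. 0)"
  proof (rule integral_dominated_convergence[OF _ _ ig])
    show "AE x in lebesgue_on {0..1}. (\<lambda>n. (g x - clamp_real (real n) (g x))\<^sup>2) \<longlonglongrightarrow> 0"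
    proof (rule AE_I2)
      fix x
      obtain n0 :: nat where n0: "\<bar>g x\<bar> \<le> real n0" using real_arch_simple by blast
      have "eventually (\<lambda>n. (g x - clamp_real (real n) (g x))\<^sup>2 = 0) sequentially"
        using eventually_ge_at_top[of n0] by eventually_elim (use n0 in \<open>auto simp: clamp_real_def\<close>)
      then show "(\<lambda>n. (g x - clamp_real (real n) (g x))\<^sup>2) \<longlonglongrightarrow> 0" by (rule tendsto_eventually)
    qed
    show "AE x in lebesgue_on {0..1}. norm ((g x - clamp_real (real n) (g x))\<^sup>2) \<le> (g x)\<^sup>2" for n
    proof (rule AE_I2)
      fix x
      have "\<bar>g x - clamp_real (real n) (g x)\<bar> \<le> \<bar>g x\<bar>" by (auto simp: clamp_real_def)
      then show "norm ((g x - clamp_real (real n) (g x))\<^sup>2) \<le> (g x)\<^sup>2"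
        by (simp add: abs_le_square_iff)
    qed
  qed auto
  then have "eventually (\<lambda>n. integral\<^sup>L (lebesgue_on {0..1}) (\<lambda>x. (g x - clamp_real (real n) (g x))\<^sup>2) < e / 4) sequentially"
    using \<open>e > 0\<close> by (intro order_tendstoD) auto
  then obtain N :: nat where N: "integral\<^sup>L (lebesgue_on {0..1}) (\<lambda>x. (g x - clamp_real (real N) (g x))\<^sup>2) < e / 4"
    by (auto simp: eventually_sequentially)
  define k where "k = (\<lambda>x. clamp_real (real N) (g x))"
  have [measurable]: "k \<in> borel_measurable (lebesgue_on {0..1})" unfolding k_def by measurable
  have "g measurable_on {0..1}"
    by (subst measurable_on_iff_borel_measurable) auto
  then obtain E h where E: "negligible E" and hc: "\<And>n. continuous_on UNIV (h n)"
    and hl: "\<And>x. x \<notin> E \<Longrightarrow> (\<lambda>n. h n x) \<longlonglongrightarrow> (if x \<in> {0..1} then g x else 0)"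
    unfolding measurable_on_def by blast
  define c where "c = (\<lambda>n::nat. \<lambda>x. clamp_real (real N) (h n x))"
  have cc: "continuous_on {0..1} (c n)" for n
    unfolding c_def clamp_real_def
    by (intro continuous_intros continuous_on_subset[OF hc]) auto
  note csq = square_integrable01_continuous[OF cc]
  have [measurable]: "c n \<in> borel_measurable (lebesgue_on {0..1})" for n
    using csq by (simp add: square_integrable01_def)
  have "(\<lambda>n. integral\<^sup>L (lebesgue_on {0..1}) (\<lambda>x. (k x - c n x)\<^sup>2))
      \<longlonglongrightarrow> integral\<^sup>L (lebesgue_on {0..1}) (\<lambda>x::real. 0)"
  proof (rule integral_dominated_convergence[where w = "\<lambda>_. (2 * real N)\<^sup>2"])
    have "\<exists>F. negligible F \<and> (\<forall>x\<in>{0..1} - F. (\<lambda>n. (k x - c n x)\<^sup>2) \<longlonglongrightarrow> 0)"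
    proof (intro exI conjI ballI)
      fix x assume x: "x \<in> {0..1} - E"
      then have "(\<lambda>n. h n x) \<longlonglongrightarrow> g x" using hl[of x] by simp
      then have "(\<lambda>n. c n x) \<longlonglongrightarrow> k x"
        unfolding c_def k_def clamp_real_def by (intro tendsto_max tendsto_min tendsto_const)
      then have "(\<lambda>n. (k x - c n x)\<^sup>2) \<longlonglongrightarrow> (k x - k x)\<^sup>2" by (intro tendsto_intros)
      then show "(\<lambda>n. (k x - c n x)\<^sup>2) \<longlonglongrightarrow> 0" by simp
    qed (rule E)
    then show "AE x in lebesgue_on {0..1}. (\<lambda>n. (k x - c n x)\<^sup>2) \<longlonglongrightarrow> 0"
      by (subst AE_lebesgue_on_iff_negligible) auto
    show "AE x in lebesgue_on {0..1}. norm ((k x - c n x)\<^sup>2) \<le> (2 * real N)\<^sup>2" for n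
    proof (rule AE_I2)
      fix x
      have "\<bar>k x - c n x\<bar> \<le> \<bar>2 * real N\<bar>" by (auto simp: k_def c_def clamp_real_def)
      then show "norm ((k x - c n x)\<^sup>2) \<le> (2 * real N)\<^sup>2"
        unfolding real_norm_def abs_power2 abs_le_square_iff[symmetric] .
    qed
  qed auto
  then have "eventually (\<lambda>n. integral\<^sup>L (lebesgue_on {0..1}) (\<lambda>x. (k x - c n x)\<^sup>2) < e / 4) sequentially"
    using \<open>e > 0\<close> by (intro order_tendstoD) auto
  then obtain n where n: "integral\<^sup>L (lebesgue_on {0..1}) (\<lambda>x. (k x - c n x)\<^sup>2) < e / 4"
    by (auto simp: eventually_sequentially)
  have ksq: "square_integrable01 k"
    unfolding square_integrable01_def
  proof
    show "integrable (lebesgue_on {0..1}) (\<lambda>x. (k x)\<^sup>2)"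
    proof (rule Bochner_Integration.integrable_bound[OF ig])
      have "\<bar>k x\<bar> \<le> \<bar>g x\<bar>" for x by (auto simp: k_def clamp_real_def)
      then show "AE x in lebesgue_on {0..1}. norm ((k x)\<^sup>2) \<le> norm ((g x)\<^sup>2)"
        by (simp add: abs_le_square_iff)
    qed auto
  qed auto
  show thesis
  proof (rule that[OF cc])
    show "integral\<^sup>L (lebesgue_on {0..1}) (\<lambda>x. (g x - c n x)\<^sup>2) < e"
      using L2_dist_triangle[OF g ksq csq, of n] N n unfolding k_def by linarith
  qed
qed

lemma poly_dense_L2:
  assumes g: "square_integrable01 g" and "e > 0"
  obtains p :: "real poly" where "integral\<^sup>L (lebesgue_on {0..1}) (\<lambda>x. (g x - poly p x)\<^sup>2) < e"
proof -
  obtain h where h: "continuous_on {0..1} h"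
    "integral\<^sup>L (lebesgue_on {0..1}) (\<lambda>x. (g x - h x)\<^sup>2) < e / 4"
    using continuous_dense_L2[OF g, of "e / 4"] \<open>e > 0\<close> by auto
  define d where "d = sqrt (e / 4)"
  have "d > 0" "d\<^sup>2 = e / 4" using \<open>e > 0\<close> by (auto simp: d_def)
  obtain f where f: "real_polynomial_function f" "\<And>x. x \<in> {0..1} \<Longrightarrow> \<bar>h x - f x\<bar> < d"
    using Stone_Weierstrass_real_polynomial_function[OF compact_Icc h(1) \<open>d > 0\<close>] by blast
  obtain a n where "f = (\<lambda>x. \<Sum>i\<le>n. a i * x ^ i)"
    using f(1) by (auto simp: real_polynomial_function_iff_sum)
  then have fp: "f x = poly (\<Sum>i\<le>n. monom (a i) i) x" for x
    by (simp add: poly_sum poly_monom)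
  define p where "p = (\<Sum>i\<le>n. monom (a i) i)"
  have pc: "continuous_on {0..1} (poly p)" by (intro continuous_intros)
  have "integral\<^sup>L (lebesgue_on {0..1}) (\<lambda>x. (h x - poly p x)\<^sup>2) \<le> integral\<^sup>L (lebesgue_on {0..1}) (\<lambda>x::real. e / 4)"
  proof (rule integral_mono)
    show "integrable (lebesgue_on {0..1}) (\<lambda>x. (h x - poly p x)\<^sup>2)"
      by (intro continuous_imp_integrable_real continuous_intros h)
    fix x :: real assume "x \<in> space (lebesgue_on {0..1})"
    then have "\<bar>h x - poly p x\<bar> \<le> \<bar>d\<bar>" using f(2)[of x] fp[of x] by (simp add: p_def)
    then show "(h x - poly p x)\<^sup>2 \<le> e / 4" by (metis \<open>d\<^sup>2 = e / 4\<close> abs_le_square_iff)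
  qed auto
  also have "\<dots> = e / 4" by (simp add: measure_restrict_space)
  finally have "integral\<^sup>L (lebesgue_on {0..1}) (\<lambda>x. (h x - poly p x)\<^sup>2) \<le> e / 4" .
  then have "integral\<^sup>L (lebesgue_on {0..1}) (\<lambda>x. (g x - poly p x)\<^sup>2) < e"
    using L2_dist_triangle[OF g square_integrable01_continuous[OF h(1)] square_integrable01_continuous[OF pc]] h(2)
    by linarith
  then show thesis by (rule that)
qed

text \<open>With derivatives of every order at hand, each one is continuous on a compact interval
  and hence bounded, which makes the preceding one Lipschitz and so absolutely continuous.\<close>

lemma sobolev_smooth:
  assumes f: "\<And>x. x \<in> {0..1} \<Longrightarrow> F 0 x = f x"
    and F: "\<And>k x. x \<in> {0..1} \<Longrightarrow> (F k has_real_derivative F (Suc k) x) (at x within {0..1})"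
  shows "f \<in> sobolev n" and "x \<in> {0..1} \<Longrightarrow> (D ^^ k) f x = F k x"
proof -
  have DF: "(D ^^ k) f x = F k x" if "x \<in> {0..1}" for k x
    by (rule D_iter_eqI[where n = k]) (use f F that in auto)
  then show "x \<in> {0..1} \<Longrightarrow> (D ^^ k) f x = F k x" .
  have der: "((D ^^ k) f has_real_derivative F (Suc k) x) (at x within {0..1})" if "x \<in> {0..1}" for k x
    using has_real_derivative_cong01[OF DF that] F[OF that] by simp
  then have diff: "(D ^^ k) f differentiable (at x within {0..1})" if "x \<in> {0..1}" for k x
    using that real_differentiable_def by blast
  have cont: "continuous_on {0..1} (F k)" for k
    by (rule DERIV_continuous_on) (rule F)
  have ac: "abs_continuous_on {0..1} ((D ^^ k) f)" for k
  proof -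
    obtain C where C: "C > 0" "\<And>x. x \<in> {0..1} \<Longrightarrow> norm (F (Suc k) x) \<le> C"
      using compact_imp_bounded[OF compact_continuous_image[OF cont[of "Suc k"] compact_Icc]]
      by (auto simp: bounded_pos)
    show ?thesis
    proof (rule abs_continuous_on_lipschitz[where C = C])
      show "\<bar>(D ^^ k) f x - (D ^^ k) f y\<bar> \<le> C * \<bar>x - y\<bar>" if "x \<in> {0..1}" "y \<in> {0..1}" for x y
        using field_differentiable_bound[of "{0..1}" "(D ^^ k) f" "F (Suc k)" C x y] der C that by simp
    qed (use C in simp)
  qed
  have c: "continuous_on {0..1} ((D ^^ n) f)"
    by (rule continuous_on_eq[OF cont[of n]]) (rule DF[symmetric])
  have ae: "AE x in lebesgue_on {0..1}. (D ^^ (n - 1)) f differentiable (at x within {0..1})"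
    by (rule AE_I2, rule diff) simp
  show "f \<in> sobolev n"
    unfolding sobolev_def mem_Collect_eq differentiable_on_def
    by (intro conjI allI impI ballI diff ac square_integrable01_continuous[OF c] ae)
qed

section \<open>Polynomials and their images under the operator\<close>

lemma poly_has_derivative01:
  "(poly ((pderiv ^^ k) p) has_real_derivative poly ((pderiv ^^ Suc k) p) x) (at x within S)"
  by (simp add: poly_DERIV DERIV_subset[OF poly_DERIV subset_UNIV])

lemma sobolev_poly: "poly p \<in> sobolev n"
  by (rule sobolev_smooth(1)[where F = "\<lambda>k. poly ((pderiv ^^ k) p)"])
     (simp, rule poly_has_derivative01)

lemma D_iter_poly:
  assumes "x \<in> {0..1}"
  shows "(D ^^ k) (poly p) x = poly ((pderiv ^^ k) p) x"
  by (rule sobolev_smooth(2)[where F = "\<lambda>k. poly ((pderiv ^^ k) p)"])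
     (simp, rule poly_has_derivative01, rule assms)

text \<open>This puts the polynomials of \<open>W5\<close> into the domain of the operator. The
  image has the form \<open>A + exp * B\<close> with polynomials \<open>A\<close> and
  \<open>B\<close>, and differentiation sends \<open>exp * B\<close> to
  \<open>exp * (B + pderiv B)\<close>, so the whole tower of derivatives is explicit.\<close>

lemma sobolev_L_op_poly: "L_op R m (poly p) \<in> sobolev n"
proof -
  define h h3 :: "real poly" where "h = [:0, 4, -4, 1:]" and "h3 = [:-6, -2, 5, 1:]"
  define A where "A = (pderiv ^^ 4) p - smult (m\<^sup>2) ((pderiv ^^ 2) p)"
  define B where "B = smult (R / exp 1) (h * (pderiv ^^ 3) p + h3 * p)"
  define b where "b = (\<lambda>k. ((\<lambda>q. q + pderiv q) ^^ k) B)"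
  show ?thesis
  proof (rule sobolev_smooth(1)[where F = "\<lambda>k x. poly ((pderiv ^^ k) A) x + exp x * poly (b k) x"])
    fix x :: real assume x: "x \<in> {0..1}"
    have "L_op R m (poly p) x = poly A x + exp x * poly B x"
    proof -
      have hx: "poly h x = x^3 - 4 * x^2 + 4 * x" "poly h3 x = x^3 + 5 * x^2 - 2 * x - 6"
        by (simp_all add: h_def h3_def algebra_simps power2_eq_square power3_eq_cube)
      have A: "poly A x = poly ((pderiv ^^ 4) p) x - m\<^sup>2 * poly ((pderiv ^^ 2) p) x"
        unfolding A_def by (simp only: poly_diff poly_smult)
      have B: "poly B x = R / exp 1 * (poly h x * poly ((pderiv ^^ 3) p) x + poly h3 x * poly p x)"
        unfolding B_def by (simp only: poly_add poly_mult poly_smult)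
      show ?thesis
        unfolding L_op_def D_iter_poly[OF x] A B hx[symmetric] by (simp only: divide_inverse) algebra
    qed
    then show "poly ((pderiv ^^ 0) A) x + exp x * poly (b 0) x = L_op R m (poly p) x"
      by (simp add: b_def)
    show "((\<lambda>x. poly ((pderiv ^^ k) A) x + exp x * poly (b k) x) has_real_derivative
        poly ((pderiv ^^ Suc k) A) x + exp x * poly (b (Suc k)) x) (at x within {0..1})" for k
    proof -
      have bS: "b (Suc k) = b k + pderiv (b k)" by (simp add: b_def)
      note der = DERIV_add[OF poly_has_derivative01[where k = k and p = A]
          DERIV_mult[OF DERIV_subset[OF DERIV_exp subset_UNIV] DERIV_subset[OF poly_DERIV[of "b k"] subset_UNIV]]]
      show ?thesis by (rule DERIV_cong[OF der]) (simp add: bS distrib_left del: funpow.simps)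
    qed
  qed
qed

lemma ex_pderiv: "\<exists>P :: real poly. pderiv P = p"
proof (rule exI)
  have "pderiv (\<Sum>i\<le>degree p. monom (coeff p i / (real i + 1)) (Suc i)) = (\<Sum>i\<le>degree p. monom (coeff p i) i)"
    unfolding higher_pderiv_sum[where n = 1, simplified]
  proof (rule sum.cong[OF refl])
    fix i
    have "real (Suc i) * (coeff p i / (real i + 1)) = coeff p i" by (simp add: field_simps)
    then show "pderiv (monom (coeff p i / (real i + 1)) (Suc i)) = monom (coeff p i) i"
      by (simp only: pderiv_monom diff_Suc_1)
  qed
  then show "pderiv (\<Sum>i\<le>degree p. monom (coeff p i / (real i + 1)) (Suc i)) = p"
    by (simp only: poly_as_sum_of_monoms)
qed

lemma ex_poly_initial_values:
  "\<exists>P :: real poly. (pderiv ^^ n) P = q \<and> (\<forall>i<n. poly ((pderiv ^^ i) P) 0 = c i)"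
proof (induction n arbitrary: c)
  case (Suc n)
  obtain P where P: "(pderiv ^^ n) P = q" "\<forall>i<n. poly ((pderiv ^^ i) P) 0 = c (Suc i)"
    using Suc[of "\<lambda>i. c (Suc i)"] by blast
  obtain Q where Q: "pderiv Q = P" using ex_pderiv by blast
  \<comment> \<open>The added constant sets the value at 0 and is invisible to all derivatives;
    these take the shifted data \<open>c (Suc i)\<close> from the induction hypothesis.\<close>
  define S where "S = Q + [:c 0 - poly Q 0:]"
  have "pderiv S = P" by (simp add: S_def Q pderiv_add pderiv_pCons)
  then have it: "(pderiv ^^ Suc i) S = (pderiv ^^ i) P" for i by (simp add: funpow_Suc_right del: funpow.simps)
  have "poly ((pderiv ^^ i) S) 0 = c i" if "i < Suc n" for i
    using that P(2) it by (cases i) (auto simp: S_def simp del: funpow.simps(2))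
  then show ?case using it[of n] P(1) by (intro exI[of _ S]) auto
qed auto

section \<open>Polynomial density under the boundary conditions, and the adjoint relation\<close>

lemma W5_sobolev: "v \<in> W5 \<Longrightarrow> v \<in> sobolev 5"
  by (simp add: W5_def)

text \<open>Approximating the fifth derivative in L2 and integrating with the initial data of
  \<open>v\<close> keeps both conditions at 0 but misses those at 1 by a little. A cubic repairs the
  value and slope at 1 without disturbing the conditions at 0; by the embedding the errors at 1, and
  with them the cubic, are small.\<close>

lemma poly_dense_W5:
  assumes v: "v \<in> W5" and "e > 0"
  obtains p where "poly p \<in> W5" "sobolev_inner 5 (\<lambda>x. v x - poly p x) (\<lambda>x. v x - poly p x) < e"
proof -
  \<comment> \<open>The final bound is
    \<open>2 * \<delta> + 2 * (144 + 1296) * \<delta> = 2882 * \<delta>\<close>, below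
    \<open>3000 * \<delta> = e\<close>.\<close>
  define \<delta> where "\<delta> = e / 3000"
  have "\<delta> > 0" using \<open>e > 0\<close> by (simp add: \<delta>_def)
  note vS = W5_sobolev[OF v]
  obtain q where q: "integral\<^sup>L (lebesgue_on {0..1}) (\<lambda>x. ((D ^^ 5) v x - poly q x)\<^sup>2) < \<delta>"
    using poly_dense_L2[OF sobolev_square_integrable[OF vS] \<open>\<delta> > 0\<close>] .
  obtain P where P: "(pderiv ^^ 5) P = q" "\<And>i. i < 5 \<Longrightarrow> poly ((pderiv ^^ i) P) 0 = (D ^^ i) v 0"
    using ex_poly_initial_values[of 5 q "\<lambda>i. (D ^^ i) v 0"] by blast
  define w0 where "w0 x = v x - poly P x" for x
  have w0: "\<forall>x\<in>{0..1}. w0 x = 1 * v x + (-1) * poly P x" by (simp add: w0_def)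
  have w0S: "w0 \<in> sobolev 5" by (rule sobolev_lincomb[OF vS sobolev_poly _ w0]) simp
  have Dw0: "(D ^^ k) w0 x = (D ^^ k) v x - poly ((pderiv ^^ k) P) x" if "k < 5" "x \<in> {0..1}" for k x
    using sobolev_D_iter_lincomb[OF vS sobolev_poly w0 that] D_iter_poly[OF that(2)] by simp
  have "integral\<^sup>L (lebesgue_on {0..1}) (\<lambda>x. (D ^^ 5) w0 x * (D ^^ 5) w0 x)
      = integral\<^sup>L (lebesgue_on {0..1}) (\<lambda>x. ((D ^^ 5) v x - poly q x)\<^sup>2)"
  proof (rule integral_cong_AE)
    have "AE x in lebesgue_on {0..1}. x \<in> space (lebesgue_on {0..1})" by (rule AE_space)
    with sobolev_AE_D_iter_lincomb[OF vS sobolev_poly zero_less_numeral w0]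
    show "AE x in lebesgue_on {0..1}. (D ^^ 5) w0 x * (D ^^ 5) w0 x = ((D ^^ 5) v x - poly q x)\<^sup>2"
      by (eventually_elim) (auto simp: D_iter_poly P(1) power2_eq_square)
    have [measurable]: "(D ^^ 5) w0 \<in> borel_measurable (lebesgue_on {0..1})"
      "(D ^^ 5) v \<in> borel_measurable (lebesgue_on {0..1})" "poly q \<in> borel_measurable (lebesgue_on {0..1})"
      using sobolev_square_integrable[OF vS] sobolev_square_integrable[OF w0S]
        square_integrable01_continuous[of "poly q"] by (auto simp: square_integrable01_def continuous_intros)
    show "(\<lambda>x. (D ^^ 5) w0 x * (D ^^ 5) w0 x) \<in> borel_measurable (lebesgue_on {0..1})" by measurable
    show "(\<lambda>x. ((D ^^ 5) v x - poly q x)\<^sup>2) \<in> borel_measurable (lebesgue_on {0..1})" by measurable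
  qed
  then have n0: "sobolev_inner 5 w0 w0 < \<delta>"
    using q Dw0[of _ 0] P(2) by (simp add: sobolev_inner_def)
  define s where "s = (\<lambda>k. (D ^^ k) w0 1)"
  have s: "\<bar>s k\<bar> \<le> 6 * sqrt \<delta>" if "k \<le> 4" for k
  proof -
    have "\<bar>s k\<bar> \<le> (real 4 + 2) * sqrt (sobolev_inner (Suc 4) w0 w0)"
      unfolding s_def by (rule sobolev_embedding) (use w0S that in auto)
    also have "\<dots> \<le> 6 * sqrt \<delta>" using n0 by simp
    finally show ?thesis .
  qed
  \<comment> \<open>The cubic \<open>\<alpha> * x + \<beta> * x^3\<close> is odd, so it and its
    second derivative vanish at 0. The coefficients solve \<open>\<alpha> + \<beta> = s 0\<close>
    and \<open>\<alpha> + 3 * \<beta> = s 1\<close>, the errors of value and slope at 1.\<close>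
  define \<alpha> \<beta> where "\<alpha> = (3 * s 0 - s 1) / 2" and "\<beta> = (s 1 - s 0) / 2"
  define c :: "real poly" where "c = [:0, \<alpha>, 0, \<beta>:]"
  have "\<bar>\<alpha>\<bar> \<le> 12 * sqrt \<delta>" "\<bar>\<beta>\<bar> \<le> 6 * sqrt \<delta>"
    using s[of 0] s[of 1] by (auto simp: \<alpha>_def \<beta>_def)
  then have ab: "\<alpha>\<^sup>2 \<le> (12 * sqrt \<delta>)\<^sup>2" "\<beta>\<^sup>2 \<le> (6 * sqrt \<delta>)\<^sup>2"
    using power_mono[of "\<bar>\<alpha>\<bar>" "12 * sqrt \<delta>" 2] power_mono[of "\<bar>\<beta>\<bar>" "6 * sqrt \<delta>" 2] by simp_all
  have "sobolev_inner 5 (poly c) (poly c) = (\<Sum>i<5. (poly ((pderiv ^^ i) c) 0)\<^sup>2)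
      + integral\<^sup>L (lebesgue_on {0..1}) (\<lambda>x. (poly ((pderiv ^^ 5) c) x)\<^sup>2)"
    unfolding sobolev_inner_def
    by (intro arg_cong2[where f = "(+)"] sum.cong Bochner_Integration.integral_cong refl)
       (auto simp: D_iter_poly power2_eq_square)
  also have "\<dots> = \<alpha>\<^sup>2 + 36 * \<beta>\<^sup>2"
    by (simp add: c_def pderiv_pCons eval_nat_numeral power2_eq_square)
  finally have c: "sobolev_inner 5 (poly c) (poly c) = \<alpha>\<^sup>2 + 36 * \<beta>\<^sup>2" .
  define p where "p = P + c"
  define w where "w x = v x - poly p x" for x
  have w: "\<forall>x\<in>{0..1}. w x = 1 * w0 x + (-1) * poly c x" by (simp add: w_def w0_def p_def)
  have wS: "w \<in> sobolev 5" by (rule sobolev_lincomb[OF w0S sobolev_poly _ w]) simp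
  \<comment> \<open>The sum is the companion of the difference \<open>w\<close> in the parallelogram
    law; dropping its nonnegative squared norm bounds that of \<open>w\<close>.\<close>
  define w' where "w' x = w0 x + poly c x" for x
  have w': "\<forall>x\<in>{0..1}. w' x = 1 * w0 x + 1 * poly c x" by (simp add: w'_def)
  have w'S: "w' \<in> sobolev 5" by (rule sobolev_lincomb[OF w0S sobolev_poly _ w']) simp
  have par: "sobolev_inner 5 w w + sobolev_inner 5 w' w'
      = 2 * sobolev_inner 5 w0 w0 + 2 * sobolev_inner 5 (poly c) (poly c)"
    using sobolev_inner_lincomb[OF w0S sobolev_poly wS _ w] sobolev_inner_lincomb[OF w0S sobolev_poly w'S _ w']
      sobolev_inner_lincomb[OF w0S sobolev_poly w0S _ w] sobolev_inner_lincomb[OF w0S sobolev_poly w0S _ w']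
      sobolev_inner_lincomb[OF w0S sobolev_poly sobolev_poly[of c] _ w] sobolev_inner_lincomb[OF w0S sobolev_poly sobolev_poly[of c] _ w']
    by (simp add: sobolev_inner_commute)
  have "sobolev_inner 5 w w \<le> 2 * \<delta> + 2 * (\<alpha>\<^sup>2 + 36 * \<beta>\<^sup>2)"
    unfolding c[symmetric] using par n0 sobolev_inner_nonneg[of 5 w'] by linarith
  also have "\<dots> \<le> 2 * \<delta> + 2 * (144 * \<delta> + 36 * (36 * \<delta>))"
    using ab \<open>\<delta> > 0\<close> by (simp add: power_mult_distrib)
  also have "\<dots> < e" using \<open>e > 0\<close> by (simp add: \<delta>_def)
  finally have small: "sobolev_inner 5 (\<lambda>x. v x - poly p x) (\<lambda>x. v x - poly p x) < e"
    by (simp add: w_def[abs_def])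
  have v0: "v 0 = 0" "v 1 = 0" "D v 1 = 0" "(D ^^ 2) v 0 = 0" using v by (auto simp: W5_def)
  have "D (poly p) 1 = poly (pderiv p) 1" using D_iter_poly[of 1 1 p] by simp
  moreover have "s 1 = - poly (pderiv P) 1" using Dw0[of 1 1] v0 by (simp add: s_def)
  moreover have "poly (pderiv c) 1 = s 1" by (simp add: c_def pderiv_pCons \<alpha>_def \<beta>_def field_simps)
  ultimately have "D (poly p) 1 = 0" by (simp add: p_def pderiv_add)
  moreover have "poly p 0 = 0" using P(2)[of 0] v0 by (simp add: p_def c_def)
  moreover have "poly p 1 = 0" using Dw0[of 0 1] v0 by (simp add: p_def c_def s_def \<alpha>_def \<beta>_def field_simps)
  moreover have "(D ^^ 2) (poly p) 0 = 0"
    using P(2)[of 2] v0(4) D_iter_poly[of 0 2 p]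
    by (simp add: p_def c_def pderiv_add pderiv_pCons eval_nat_numeral)
  ultimately have "poly p \<in> W5" by (simp add: W5_def sobolev_poly)
  then show thesis using small that by blast
qed

lemma L_op_lincomb:
  assumes "u \<in> sobolev 5" "v \<in> sobolev 5" "\<forall>x\<in>{0..1}. w x = a * u x + b * v x" "x \<in> {0..1}"
  shows "L_op R m w x = a * L_op R m u x + b * L_op R m v x"
proof -
  have "(D ^^ k) w x = a * (D ^^ k) u x + b * (D ^^ k) v x" if "k < 5" for k
    by (rule sobolev_D_iter_lincomb[OF assms(1-3) that assms(4)])
  then have "(D ^^ 2) w x = a * (D ^^ 2) u x + b * (D ^^ 2) v x"
    "(D ^^ 3) w x = a * (D ^^ 3) u x + b * (D ^^ 3) v x"
    "(D ^^ 4) w x = a * (D ^^ 4) u x + b * (D ^^ 4) v x"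
    "w x = a * u x + b * v x"
    using assms(3,4) by simp_all
  then show ?thesis
    unfolding L_op_def divide_inverse by algebra
qed

text \<open>The passage to the limit works because both sides are bounded by the \<open>W5\<close>
  norm of \<open>v\<close>: the left one contains only derivatives up to order 4 at one point, which
  the embedding controls, and the right one falls under Cauchy-Schwarz.\<close>

lemma L_op_eq_inner_adjoint:
  assumes r: "reproducing_kernel W4 (sobolev_inner 4) r" and y: "y \<in> {0..1}"
    and adj: "adjoint_value (L_op R m) (r y) \<Psi>" and v: "v \<in> W5"
  shows "L_op R m v y = sobolev_inner 5 v \<Psi>"
proof -
  note vS = W5_sobolev[OF v]
  have PS: "\<Psi> \<in> sobolev 5" using adj by (simp add: adjoint_value_def W5_def)
  define h3 h0 where "h3 = R * (exp y / exp 1) * (y^3 - 4 * y^2 + 4 * y)"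
    and "h0 = R * (exp y / exp 1) * (y^3 + 5 * y^2 - 2 * y - 6)"
  \<comment> \<open>A bound for the norm of the functional that maps \<open>v\<close> to
    \<open>L_op R m v y - sobolev_inner 5 v \<Psi>\<close>; the 6 is the embedding constant
    \<open>4 + 2\<close>.\<close>
  define C where "C = 6 * (1 + \<bar>h3\<bar> + m\<^sup>2 + \<bar>h0\<bar>) + sqrt (sobolev_inner 5 \<Psi> \<Psi>)"
  have "C > 0" unfolding C_def by (intro add_pos_nonneg mult_pos_pos) (auto simp: sobolev_inner_nonneg add_pos_nonneg)
  have bound: "\<bar>L_op R m v y - sobolev_inner 5 v \<Psi>\<bar> \<le> C * e" if "e > 0" for e
  proof -
    obtain p where p: "poly p \<in> W5" "sobolev_inner 5 (\<lambda>x. v x - poly p x) (\<lambda>x. v x - poly p x) < e\<^sup>2"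
      using poly_dense_W5[OF v, of "e\<^sup>2"] \<open>e > 0\<close> by auto
    define w where "w = (\<lambda>x. v x - poly p x)"
    have w: "\<forall>x\<in>{0..1}. w x = 1 * v x + (-1) * poly p x" by (simp add: w_def)
    have wS: "w \<in> sobolev 5" by (rule sobolev_lincomb[OF vS sobolev_poly _ w]) simp
    have "sqrt (sobolev_inner 5 w w) \<le> e" using p(2) \<open>e > 0\<close> by (intro real_le_lsqrt) (auto simp: w_def)
    have LP: "L_op R m (poly p) \<in> W4" by (simp add: W4_def sobolev_L_op_poly)
    have "L_op R m (poly p) y = sobolev_inner 4 (L_op R m (poly p)) (r y)"
      using r y LP by (simp add: reproducing_kernel_def)
    also have "\<dots> = sobolev_inner 5 (poly p) \<Psi>"
      using adj p(1) LP by (simp add: adjoint_value_def)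
    finally have eq: "L_op R m v y - sobolev_inner 5 v \<Psi> = L_op R m w y - sobolev_inner 5 w \<Psi>"
      using L_op_lincomb[OF vS sobolev_poly w y] sobolev_inner_lincomb[OF vS sobolev_poly PS _ w] by simp
    have emb: "\<bar>(D ^^ k) w y\<bar> \<le> 6 * e" if "k \<le> 4" for k
    proof -
      have "\<bar>(D ^^ k) w y\<bar> \<le> (real 4 + 2) * sqrt (sobolev_inner (Suc 4) w w)"
        by (rule sobolev_embedding) (use wS that y in auto)
      then show ?thesis using \<open>sqrt (sobolev_inner 5 w w) \<le> e\<close> by simp
    qed
    have Lw: "L_op R m w y = (D ^^ 4) w y + h3 * (D ^^ 3) w y - m\<^sup>2 * (D ^^ 2) w y + h0 * (D ^^ 0) w y"
      unfolding L_op_def h3_def h0_def by simp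
    have "\<bar>L_op R m w y\<bar> \<le> \<bar>(D ^^ 4) w y\<bar> + \<bar>h3\<bar> * \<bar>(D ^^ 3) w y\<bar> + m\<^sup>2 * \<bar>(D ^^ 2) w y\<bar> + \<bar>h0\<bar> * \<bar>(D ^^ 0) w y\<bar>"
    proof -
      have "\<bar>a + b - c + d\<bar> \<le> \<bar>a\<bar> + \<bar>b\<bar> + \<bar>c\<bar> + \<bar>d\<bar>" for a b c d :: real by linarith
      from this[of "(D ^^ 4) w y" "h3 * (D ^^ 3) w y" "m\<^sup>2 * (D ^^ 2) w y" "h0 * (D ^^ 0) w y"]
      show ?thesis by (simp only: Lw abs_mult abs_power2)
    qed
    also have "\<dots> \<le> 6 * e + \<bar>h3\<bar> * (6 * e) + m\<^sup>2 * (6 * e) + \<bar>h0\<bar> * (6 * e)"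
      by (intro add_mono mult_left_mono emb) auto
    finally have 1: "\<bar>L_op R m w y\<bar> \<le> 6 * (1 + \<bar>h3\<bar> + m\<^sup>2 + \<bar>h0\<bar>) * e" by (simp add: algebra_simps)
    have "(sobolev_inner 5 w \<Psi>)\<^sup>2 \<le> sobolev_inner 5 w w * sobolev_inner 5 \<Psi> \<Psi>"
      by (rule sobolev_inner_cauchy_schwarz[OF wS PS]) simp
    then have "\<bar>sobolev_inner 5 w \<Psi>\<bar> \<le> sqrt (sobolev_inner 5 w w * sobolev_inner 5 \<Psi> \<Psi>)"
      using real_sqrt_le_mono real_sqrt_abs by metis
    also have "\<dots> \<le> e * sqrt (sobolev_inner 5 \<Psi> \<Psi>)"
      unfolding real_sqrt_mult using \<open>sqrt (sobolev_inner 5 w w) \<le> e\<close>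
      by (intro mult_right_mono) (auto simp: sobolev_inner_nonneg)
    finally have 2: "\<bar>sobolev_inner 5 w \<Psi>\<bar> \<le> e * sqrt (sobolev_inner 5 \<Psi> \<Psi>)" .
    have "\<bar>L_op R m v y - sobolev_inner 5 v \<Psi>\<bar> \<le> \<bar>L_op R m w y\<bar> + \<bar>sobolev_inner 5 w \<Psi>\<bar>"
      unfolding eq by (rule abs_triangle_ineq4)
    with 1 2 show ?thesis by (simp add: C_def algebra_simps)
  qed
  have "\<bar>L_op R m v y - sobolev_inner 5 v \<Psi>\<bar> \<le> 0 + e" if "e > 0" for e
    using bound[of "e / C"] that \<open>C > 0\<close> by simp
  then have "\<bar>L_op R m v y - sobolev_inner 5 v \<Psi>\<bar> \<le> 0" by (rule field_le_epsilon)
  then show ?thesis by simp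
qed

section \<open>Linear differential equations on the unit interval\<close>

lemma has_real_derivative_nonneg_mono01:
  fixes f :: "real \<Rightarrow> real"
  assumes der: "\<And>x. x \<in> {0..1} \<Longrightarrow> (f has_real_derivative f' x) (at x within {0..1})"
    and nonneg: "\<And>x. x \<in> {0..1} \<Longrightarrow> 0 \<le> f' x"
    and ab: "0 \<le> a" "a \<le> b" "b \<le> 1"
  shows "f a \<le> f b"
proof (rule DERIV_nonneg_imp_increasing_open[OF ab(2)])
  show "continuous_on {a..b} f"
    by (rule continuous_on_subset[OF DERIV_continuous_on[OF der]]) (use ab in auto)
  fix x assume "a < x" "x < b"
  then have "x \<in> {0<..<1}" "x \<in> {0..1}" using ab by auto
  then show "\<exists>y. DERIV f x :> y \<and> 0 \<le> y"
    using der[of x] nonneg[of x] at_within_Icc_at[of 0 x 1] by auto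
qed

text \<open>The product \<open>exp (- K * x) * N x\<close> is nonincreasing and starts at 0.\<close>

lemma gronwall_zero01:
  fixes N :: "real \<Rightarrow> real"
  assumes der: "\<And>x. x \<in> {0..1} \<Longrightarrow> (N has_real_derivative N' x) (at x within {0..1})"
    and le: "\<And>x. x \<in> {0..1} \<Longrightarrow> N' x \<le> K * N x"
    and "N 0 = 0" "\<And>x. x \<in> {0..1} \<Longrightarrow> 0 \<le> N x" and x: "x \<in> {0..1}"
  shows "N x = 0"
proof -
  have "- (exp (- K * 0) * N 0) \<le> - (exp (- K * x) * N x)"
  proof (rule has_real_derivative_nonneg_mono01[where f = "\<lambda>x. - (exp (- K * x) * N x)" and f' = "\<lambda>x. exp (- K * x) * (K * N x - N' x)"])
    show "((\<lambda>x. - (exp (- K * x) * N x)) has_real_derivative exp (- K * y) * (K * N y - N' y)) (at y within {0..1})"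
      if "y \<in> {0..1}" for y
      by (auto intro!: derivative_eq_intros der[OF that] simp: algebra_simps)
    show "0 \<le> exp (- K * y) * (K * N y - N' y)" if "y \<in> {0..1}" for y
      using le[OF that] by simp
  qed (use x in auto)
  then have "exp (- K * x) * N x \<le> 0" using assms(3) by simp
  then have "N x \<le> 0" by (simp add: mult_le_0_iff)
  then show ?thesis using assms(4)[OF x] by simp
qed

text \<open>Squaring removes the kink of the negative part: the difference quotient at 0 is at most
  \<open>\<bar>h\<bar>\<close>. This is what allows negative parts in a differential
  inequality.\<close>

lemma has_real_derivative_neg_part_square:
  "((\<lambda>y::real. (max 0 (- y))\<^sup>2) has_real_derivative - 2 * max 0 (- y)) (at y)"
proof (cases "y = 0")
  case True
  have "(\<lambda>h::real. ((max 0 (- (0 + h)))\<^sup>2 - (max 0 (- 0))\<^sup>2) / h) \<midarrow>0\<rightarrow> 0"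
  proof (rule Lim_null_comparison)
    show "(\<lambda>h::real. \<bar>h\<bar>) \<midarrow>0\<rightarrow> 0" by (intro tendsto_rabs_zero tendsto_ident_at)
    show "eventually (\<lambda>h::real. norm (((max 0 (- (0 + h)))\<^sup>2 - (max 0 (- 0))\<^sup>2) / h) \<le> \<bar>h\<bar>) (at 0)"
      by (rule always_eventually) (auto simp: max_def power2_eq_square)
  qed
  then show ?thesis using True by (simp add: DERIV_def)
next
  case False
  show ?thesis
  proof (cases "y < 0")
    case True
    have "((\<lambda>y. y\<^sup>2) has_real_derivative - 2 * max 0 (- y)) (at y)"
      using True by (auto intro!: derivative_eq_intros)
    then show ?thesis
      by (rule has_field_derivative_transform_within_open[where S = "{..<0}"]) (use True in auto)
  next
    case F: False
    have "((\<lambda>y. 0) has_real_derivative - 2 * max 0 (- y)) (at y)"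
      using F by (auto intro!: derivative_eq_intros)
    then show ?thesis
      by (rule has_field_derivative_transform_within_open[where S = "{0<..}"]) (use F False in auto)
  qed
qed

text \<open>
  The sum of the squared negative parts of the unknowns satisfies a Gronwall inequality.
\<close>

lemma cooperative_system_nonneg:
  fixes y :: "'i \<Rightarrow> real \<Rightarrow> real"
  assumes "finite J"
    and der: "\<And>j x. j \<in> J \<Longrightarrow> x \<in> {0..1} \<Longrightarrow> (y j has_real_derivative y' j x) (at x within {0..1})"
    and coop: "\<And>j x. j \<in> J \<Longrightarrow> x \<in> {0..1} \<Longrightarrow> - C * (\<Sum>i\<in>J. max 0 (- y i x)) \<le> y' j x"
    and "C \<ge> 0" and init: "\<And>j. j \<in> J \<Longrightarrow> 0 \<le> y j 0" and "j \<in> J" "x \<in> {0..1}"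
  shows "0 \<le> y j x"
proof -
  define n where "n = (\<lambda>i x. max 0 (- y i x))"
  have n0: "n i x \<ge> 0" for i x by (simp add: n_def)
  define N where "N = (\<lambda>x. \<Sum>i\<in>J. (n i x)\<^sup>2)"
  have "N x = 0"
  proof (rule gronwall_zero01[where N = N and K = "2 * C * card J"])
    show "(N has_real_derivative (\<Sum>i\<in>J. - 2 * n i x * y' i x)) (at x within {0..1})" if x: "x \<in> {0..1}" for x
      unfolding N_def n_def
      by (intro DERIV_sum DERIV_chain2[OF has_real_derivative_neg_part_square der] x)
    show "(\<Sum>i\<in>J. - 2 * n i x * y' i x) \<le> 2 * C * card J * N x" if x: "x \<in> {0..1}" for x
    proof -
      have "(\<Sum>i\<in>J. - 2 * n i x * y' i x) \<le> (\<Sum>i\<in>J. 2 * n i x * (C * (\<Sum>i\<in>J. n i x)))"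
      proof (rule sum_mono)
        fix i assume "i \<in> J"
        then have "- y' i x \<le> C * (\<Sum>i\<in>J. n i x)" using coop[of i x] x by (simp add: n_def)
        then have "2 * n i x * (- y' i x) \<le> 2 * n i x * (C * (\<Sum>i\<in>J. n i x))"
          using n0 by (intro mult_left_mono) auto
        then show "- 2 * n i x * y' i x \<le> 2 * n i x * (C * (\<Sum>i\<in>J. n i x))" by simp
      qed
      also have "\<dots> = 2 * C * (\<Sum>i\<in>J. n i x)\<^sup>2"
        by (simp add: sum_distrib_right[symmetric] sum_distrib_left[symmetric] power2_eq_square)
      also have "\<dots> \<le> 2 * C * (card J * N x)"
        using sum_squared_le_sum_of_squares[of "\<lambda>i. n i x" J] assms(1,4) unfolding N_def
        by (intro mult_left_mono) (auto simp: mult.commute)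
      finally show ?thesis by simp
    qed
    show "N 0 = 0"
      unfolding N_def
    proof (rule sum.neutral, rule ballI)
      fix i assume "i \<in> J"
      from init[OF this] show "(n i 0)\<^sup>2 = 0" by (auto simp: n_def max_def)
    qed
  qed (use assms in \<open>auto simp: N_def sum_nonneg\<close>)
  then have "n j x = 0" using assms(1,6) by (simp add: N_def sum_nonneg_eq_0_iff)
  then show ?thesis by (simp add: n_def max_def split: if_splits)
qed

section \<open>Existence for initial value problems\<close>

lemma picard_lindeloef01:
  fixes f :: "real \<Rightarrow> 'a::banach \<Rightarrow> 'a"
  assumes cont: "\<And>\<phi>. continuous_on {0..1} \<phi> \<Longrightarrow> continuous_on {0..1} (\<lambda>t. f t (\<phi> t))"
    and lip: "\<And>t a b. t \<in> {0..1} \<Longrightarrow> norm (f t a - f t b) \<le> K * norm (a - b)" and "K > 0"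
  obtains z where "z 0 = z0" "\<And>t. t \<in> {0..1} \<Longrightarrow> (z has_vector_derivative f t (z t)) (at t within {0..1})"
proof -
  \<comment> \<open>The contraction factor will be \<open>K / L\<close>, here 1/2.\<close>
  define L where "L = 2 * K"
  have "L > 0" using \<open>K > 0\<close> by (simp add: L_def)
  \<comment> \<open>The weight makes the integral operator a contraction on all of the interval at once.\<close>
  define F where "F \<phi> t = f t (exp (L * t) *\<^sub>R \<phi> t)" for \<phi> :: "real \<Rightarrow> 'a" and t
  define T where "T \<phi> x = exp (- L * x) *\<^sub>R (z0 + integral {0..x} (F \<phi>))" for \<phi> :: "real \<Rightarrow> 'a" and x
  have Fc: "continuous_on {0..1} (F \<phi>)" if "continuous_on {0..1} \<phi>" for \<phi>
    unfolding F_def by (intro cont continuous_intros that)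
  have Tder: "((\<lambda>x. z0 + integral {0..x} (F \<phi>)) has_vector_derivative F \<phi> x) (at x within {0..1})"
    if "continuous_on {0..1} \<phi>" "x \<in> {0..1}" for \<phi> x
    using integral_has_vector_derivative[OF Fc[OF that(1)] that(2)] by (auto intro!: derivative_eq_intros)
  have Tc: "continuous_on {0..1} (T \<phi>)" if "continuous_on {0..1} \<phi>" for \<phi>
    unfolding T_def
    by (intro continuous_intros continuous_on_vector_derivative[OF Tder] that)
  have Tlip: "norm (T \<phi> x - T \<psi> x) \<le> 1 / 2 * d"
    if c: "continuous_on {0..1} \<phi>" "continuous_on {0..1} \<psi>"
      and d: "\<And>t. t \<in> {0..1} \<Longrightarrow> norm (\<phi> t - \<psi> t) \<le> d" and x: "x \<in> {0..1}" for \<phi> \<psi> x d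
  proof -
    have "d \<ge> 0" by (rule order_trans[OF norm_ge_zero d[of 0]]) simp
    have int: "F \<phi> integrable_on {0..x}" "F \<psi> integrable_on {0..x}"
      using x by (auto intro!: integrable_continuous_real continuous_on_subset[OF Fc] c)
    have eint: "((\<lambda>t. K * d * exp (L * t)) has_integral (K * d / L * exp (L * x) - K * d / L * exp (L * 0))) {0..x}"
      using x \<open>L > 0\<close>
      by (intro fundamental_theorem_of_calculus)
         (auto simp: has_real_derivative_iff_has_vector_derivative[symmetric] intro!: derivative_eq_intros)
    have "norm (integral {0..x} (\<lambda>t. F \<phi> t - F \<psi> t)) \<le> integral {0..x} (\<lambda>t. K * d * exp (L * t))"
    proof (rule integral_norm_bound_integral)
      fix t assume t: "t \<in> {0..x}"
      then have t1: "t \<in> {0..1}" using x by auto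
      have "norm (F \<phi> t - F \<psi> t) \<le> K * norm (exp (L * t) *\<^sub>R \<phi> t - exp (L * t) *\<^sub>R \<psi> t)"
        unfolding F_def by (rule lip[OF t1])
      also have "\<dots> = K * exp (L * t) * norm (\<phi> t - \<psi> t)"
        by (simp add: scaleR_diff_right[symmetric])
      also have "\<dots> \<le> K * exp (L * t) * d"
        using d[OF t1] \<open>K > 0\<close> by (intro mult_left_mono) auto
      finally show "norm (F \<phi> t - F \<psi> t) \<le> K * d * exp (L * t)" by (simp add: mult_ac)
    qed (use int eint in \<open>auto intro: integrable_diff\<close>)
    also have "\<dots> = K * d / L * (exp (L * x) - 1)"
      unfolding integral_unique[OF eint] by (simp add: algebra_simps)
    also have "\<dots> \<le> K * d / L * exp (L * x)"
      using \<open>K > 0\<close> \<open>L > 0\<close> \<open>d \<ge> 0\<close> by (intro mult_left_mono) auto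
    finally have *: "norm (integral {0..x} (F \<phi>) - integral {0..x} (F \<psi>)) \<le> d / 2 * exp (L * x)"
      using int \<open>K > 0\<close> by (simp add: integral_diff L_def)
    have "norm (T \<phi> x - T \<psi> x) = exp (- L * x) * norm (integral {0..x} (F \<phi>) - integral {0..x} (F \<psi>))"
      unfolding T_def by (simp add: scaleR_diff_right[symmetric])
    also have "\<dots> \<le> exp (- L * x) * (d / 2 * exp (L * x))"
      using * by (intro mult_left_mono) auto
    also have "\<dots> = d / 2" by (simp add: exp_minus field_simps)
    finally show ?thesis by simp
  qed
  \<comment> \<open>The complete space for the fixed point theorem consists of bounded continuous
    functions on the whole line; composing with \<open>clamp 0 1\<close> extends a function from the
    interval to the line with the same range.\<close>
  have ext: "(\<lambda>x. T \<phi> (clamp 0 1 x)) \<in> bcontfun" if "continuous_on {0..1} \<phi>" for \<phi>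
    unfolding bcontfun_def
    using clamp_continuous_on[of 0 1 "T \<phi>" UNIV] clamp_bounded[of "T \<phi>" 0 1] Tc[OF that]
      compact_imp_bounded[OF compact_continuous_image[OF Tc[OF that] compact_Icc]]
    by simp
  define \<Phi> where "\<Phi> \<phi> = Bcontfun (\<lambda>x. T (apply_bcontfun \<phi>) (clamp 0 1 x))" for \<phi> :: "real \<Rightarrow>\<^sub>C 'a"
  have \<Phi>: "apply_bcontfun (\<Phi> \<phi>) x = T (apply_bcontfun \<phi>) (clamp 0 1 x)" for \<phi> x
    unfolding \<Phi>_def by (subst Bcontfun_inverse[OF ext]) auto
  have "\<exists>!\<phi>. \<Phi> \<phi> = \<phi>"
  proof (rule banach_fix_type[where c = "1/2"])
    show "\<forall>\<phi> \<psi>. dist (\<Phi> \<phi>) (\<Phi> \<psi>) \<le> 1 / 2 * dist \<phi> \<psi>"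
    proof (intro allI dist_bound)
      fix \<phi> \<psi> :: "real \<Rightarrow>\<^sub>C 'a" and x :: real
      have "clamp 0 1 x \<in> {0..1}" using clamp_in_interval[of 0 1 x] by simp
      then show "dist (apply_bcontfun (\<Phi> \<phi>) x) (apply_bcontfun (\<Phi> \<psi>) x) \<le> 1 / 2 * dist \<phi> \<psi>"
        unfolding \<Phi> dist_norm[of "T _ _"]
        by (intro Tlip) (auto simp: dist_norm[symmetric] dist_bounded)
    qed
  qed auto
  then obtain \<phi> where \<phi>: "\<Phi> \<phi> = \<phi>" by blast
  define z where "z = (\<lambda>x. z0 + integral {0..x} (F (apply_bcontfun \<phi>)))"
  have \<phi>z: "exp (L * x) *\<^sub>R apply_bcontfun \<phi> x = z x" if "x \<in> {0..1}" for x
  proof -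
    have "apply_bcontfun \<phi> x = T (apply_bcontfun \<phi>) x"
      using \<Phi>[of \<phi> x] that by (simp add: \<phi>)
    then show ?thesis unfolding T_def z_def
      by (simp add: exp_minus)
  qed
  show thesis
  proof (rule that[of z])
    show "z 0 = z0" by (simp add: z_def)
    fix t :: real assume t: "t \<in> {0..1}"
    show "(z has_vector_derivative f t (z t)) (at t within {0..1})"
      using Tder[of "apply_bcontfun \<phi>" t] t \<phi>z[OF t] by (simp add: F_def z_def)
  qed
qed

lemma fourth_order_linear_ode_exists:
  fixes p q k :: "real \<Rightarrow> real"
  assumes c: "continuous_on {0..1} p" "continuous_on {0..1} q" "continuous_on {0..1} k"
  obtains z0 z1 z2 z3 :: "real \<Rightarrow> real" where "z0 0 = a0" "z1 0 = a1" "z2 0 = a2" "z3 0 = a3"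
    "\<And>x. x \<in> {0..1} \<Longrightarrow> (z0 has_real_derivative z1 x) (at x within {0..1})"
    "\<And>x. x \<in> {0..1} \<Longrightarrow> (z1 has_real_derivative z2 x) (at x within {0..1})"
    "\<And>x. x \<in> {0..1} \<Longrightarrow> (z2 has_real_derivative z3 x) (at x within {0..1})"
    "\<And>x. x \<in> {0..1} \<Longrightarrow> (z3 has_real_derivative p x * z3 x + q x * z2 x - k x * z0 x) (at x within {0..1})"
proof -
  have "bounded (p ` {0..1})" "bounded (q ` {0..1})" "bounded (k ` {0..1})"
    using c by (auto intro!: compact_imp_bounded compact_continuous_image)
  then obtain P Q S where PQS: "P > 0" "Q > 0" "S > 0"
    "\<And>x. x \<in> {0..1} \<Longrightarrow> \<bar>p x\<bar> \<le> P" "\<And>x. x \<in> {0..1} \<Longrightarrow> \<bar>q x\<bar> \<le> Q" "\<And>x. x \<in> {0..1} \<Longrightarrow> \<bar>k x\<bar> \<le> S"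
    unfolding bounded_pos by fastforce
  define f where "f = (\<lambda>t (v :: real \<times> real \<times> real \<times> real). (fst (snd v), fst (snd (snd v)), snd (snd (snd v)),
      p t * snd (snd (snd v)) + q t * fst (snd (snd v)) - k t * fst v))"
  \<comment> \<open>The Lipschitz constant counts 1 for each of the three shifted components and
    \<open>P + Q + S\<close> for the last component of \<open>f\<close>.\<close>
  obtain z where z: "z 0 = (a0, a1, a2, a3)"
    "\<And>t. t \<in> {0..1} \<Longrightarrow> (z has_vector_derivative f t (z t)) (at t within {0..1})"
  proof (rule picard_lindeloef01[of f "3 + P + Q + S" "(a0, a1, a2, a3)"])
    show "continuous_on {0..1} (\<lambda>t. f t (\<phi> t))" if "continuous_on {0..1} \<phi>" for \<phi>
      unfolding f_def by (intro continuous_intros that c)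
    show "norm (f t v - f t w) \<le> (3 + P + Q + S) * norm (v - w)" if t: "t \<in> {0..1}" for t v w
    proof -
      obtain d0 d1 d2 d3 where d: "v - w = (d0, d1, d2, d3)" by (metis prod_cases4)
      have n: "norm (a, b) \<le> norm a + norm b" for a :: "'x::real_normed_vector" and b :: "'y::real_normed_vector"
        using norm_Pair_le by blast
      have comp: "\<bar>d0\<bar> \<le> norm (v - w)" "\<bar>d1\<bar> \<le> norm (v - w)" "\<bar>d2\<bar> \<le> norm (v - w)" "\<bar>d3\<bar> \<le> norm (v - w)"
        unfolding d using norm_fst_le[of d0 "(d1, d2, d3)"] norm_snd_le[of "(d1, d2, d3)" d0]
          norm_fst_le[of d1 "(d2, d3)"] norm_snd_le[of "(d2, d3)" d1]
          norm_fst_le[of d2 d3] norm_snd_le[of d3 d2] by simp_all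
      have "f t v - f t w = (d1, d2, d3, p t * d3 + q t * d2 - k t * d0)"
        using d by (cases v; cases w) (auto simp: f_def algebra_simps)
      then have "norm (f t v - f t w) \<le> \<bar>d1\<bar> + (\<bar>d2\<bar> + (\<bar>d3\<bar> + \<bar>p t * d3 + q t * d2 - k t * d0\<bar>))"
        using n[of d1 "(d2, d3, p t * d3 + q t * d2 - k t * d0)"] n[of d2 "(d3, p t * d3 + q t * d2 - k t * d0)"]
          n[of d3 "p t * d3 + q t * d2 - k t * d0"] by simp
      also have "\<bar>p t * d3 + q t * d2 - k t * d0\<bar> \<le> \<bar>p t\<bar> * \<bar>d3\<bar> + \<bar>q t\<bar> * \<bar>d2\<bar> + \<bar>k t\<bar> * \<bar>d0\<bar>"
        unfolding abs_mult[symmetric] by linarith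
      also have "\<dots> \<le> P * norm (v - w) + Q * norm (v - w) + S * norm (v - w)"
        using PQS t comp by (intro add_mono mult_mono) auto
      finally show ?thesis using comp by (simp add: algebra_simps)
    qed
  qed (use PQS in auto)
  have der: "((\<lambda>t. fst (z t)) has_real_derivative fst (snd (z t))) (at t within {0..1})"
    "((\<lambda>t. fst (snd (z t))) has_real_derivative fst (snd (snd (z t)))) (at t within {0..1})"
    "((\<lambda>t. fst (snd (snd (z t)))) has_real_derivative snd (snd (snd (z t)))) (at t within {0..1})"
    "((\<lambda>t. snd (snd (snd (z t)))) has_real_derivative p t * snd (snd (snd (z t))) + q t * fst (snd (snd (z t))) - k t * fst (z t)) (at t within {0..1})"
    if t: "t \<in> {0..1}" for t
  proof -
    have s: "((\<lambda>t. snd (w t)) has_vector_derivative snd w') (at t within {0..1})"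
      and f: "((\<lambda>t. fst (w t)) has_vector_derivative fst w') (at t within {0..1})"
      if "(w has_vector_derivative w') (at t within {0..1})"
      for w :: "real \<Rightarrow> 'x::real_normed_vector \<times> 'y::real_normed_vector" and w'
      using that bounded_linear.has_vector_derivative[OF bounded_linear_snd] bounded_linear.has_vector_derivative[OF bounded_linear_fst]
      by blast+
    note d = z(2)[OF t]
    show "((\<lambda>t. fst (z t)) has_real_derivative fst (snd (z t))) (at t within {0..1})"
      "((\<lambda>t. fst (snd (z t))) has_real_derivative fst (snd (snd (z t)))) (at t within {0..1})"
      "((\<lambda>t. fst (snd (snd (z t)))) has_real_derivative snd (snd (snd (z t)))) (at t within {0..1})"
      "((\<lambda>t. snd (snd (snd (z t)))) has_real_derivative p t * snd (snd (snd (z t))) + q t * fst (snd (snd (z t))) - k t * fst (z t)) (at t within {0..1})"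
      using f[OF d] f[OF s[OF d]] f[OF s[OF s[OF d]]] s[OF s[OF s[OF d]]]
      by (simp_all add: f_def has_real_derivative_iff_has_vector_derivative)
  qed
  show thesis
    by (rule that[of "\<lambda>t. fst (z t)" "\<lambda>t. fst (snd (z t))" "\<lambda>t. fst (snd (snd (z t)))" "\<lambda>t. snd (snd (snd (z t)))"])
       (use z(1) der in auto)
qed

text \<open>
  If \<open>z\<close> is the solution with initial data dual to those of \<open>v\<close>, the \<open>2 \<times> 2\<close> minors of the
  derivative matrix of \<open>(z, v)\<close> form a linear system with nonnegative coefficients: in the
  derivatives of the minors the terms with the negative coefficient \<open>- k\<close> either cancel or
  occur with the rows reversed.
\<close>

lemma fourth_order_boundary_problem_unique:
  fixes p q k v0 v1 v2 v3 :: "real \<Rightarrow> real"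
  assumes c: "continuous_on {0..1} p" "continuous_on {0..1} q" "continuous_on {0..1} k"
    and nonneg: "\<And>x. x \<in> {0..1} \<Longrightarrow> 0 \<le> p x" "\<And>x. x \<in> {0..1} \<Longrightarrow> 0 \<le> q x" "\<And>x. x \<in> {0..1} \<Longrightarrow> 0 \<le> k x"
    and v: "\<And>x. x \<in> {0..1} \<Longrightarrow> (v0 has_real_derivative v1 x) (at x within {0..1})"
      "\<And>x. x \<in> {0..1} \<Longrightarrow> (v1 has_real_derivative v2 x) (at x within {0..1})"
      "\<And>x. x \<in> {0..1} \<Longrightarrow> (v2 has_real_derivative v3 x) (at x within {0..1})"
      "\<And>x. x \<in> {0..1} \<Longrightarrow> (v3 has_real_derivative p x * v3 x + q x * v2 x - k x * v0 x) (at x within {0..1})"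
    and bc: "v0 0 = 0" "v2 0 = 0" "v0 1 = 0" "v1 1 = 0" and "x \<in> {0..1}"
  shows "v0 x = 0"
proof -
  have "bounded (p ` {0..1})" "bounded (q ` {0..1})" "bounded (k ` {0..1})"
    using c by (auto intro!: compact_imp_bounded compact_continuous_image)
  then obtain P Q S where PQS: "P > 0" "Q > 0" "S > 0"
    "\<And>x. x \<in> {0..1} \<Longrightarrow> \<bar>p x\<bar> \<le> P" "\<And>x. x \<in> {0..1} \<Longrightarrow> \<bar>q x\<bar> \<le> Q" "\<And>x. x \<in> {0..1} \<Longrightarrow> \<bar>k x\<bar> \<le> S"
    unfolding bounded_pos by fastforce
  define C where "C = 1 + P + Q + S"
  have C: "1 \<le> C" "\<And>x. x \<in> {0..1} \<Longrightarrow> p x \<le> C" "\<And>x. x \<in> {0..1} \<Longrightarrow> q x \<le> C" "\<And>x. x \<in> {0..1} \<Longrightarrow> k x \<le> C"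
    using PQS unfolding C_def by (auto, (smt (verit) PQS atLeastAtMost_iff)+)
  \<comment> \<open>With these data all minors vanish at 0 except \<open>a24\<close>, which starts
    at \<open>(v1 0)^2 + (v3 0)^2\<close>.\<close>
  obtain z0 z1 z2 z3 where z0: "z0 0 = 0" "z1 0 = v3 0" "z2 0 = 0" "z3 0 = - v1 0"
    and z: "\<And>x. x \<in> {0..1} \<Longrightarrow> (z0 has_real_derivative z1 x) (at x within {0..1})"
    "\<And>x. x \<in> {0..1} \<Longrightarrow> (z1 has_real_derivative z2 x) (at x within {0..1})"
    "\<And>x. x \<in> {0..1} \<Longrightarrow> (z2 has_real_derivative z3 x) (at x within {0..1})"
    "\<And>x. x \<in> {0..1} \<Longrightarrow> (z3 has_real_derivative p x * z3 x + q x * z2 x - k x * z0 x) (at x within {0..1})"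
    using fourth_order_linear_ode_exists[OF c, of 0 "v3 0" 0 "- v1 0"] by metis
  define a12 a13 a14 a23 a24 a34 where "a12 x = z0 x * v1 x - z1 x * v0 x"
    and "a13 x = z0 x * v2 x - z2 x * v0 x" and "a14 x = z0 x * v3 x - z3 x * v0 x"
    and "a23 x = z1 x * v2 x - z2 x * v1 x" and "a24 x = z1 x * v3 x - z3 x * v1 x"
    and "a34 x = z2 x * v3 x - z3 x * v2 x" for x
  note a_defs = a12_def a13_def a14_def a23_def a24_def a34_def
  have der: "(a12 has_real_derivative a13 x) (at x within {0..1})"
    "(a13 has_real_derivative a14 x + a23 x) (at x within {0..1})"
    "(a14 has_real_derivative a24 x + p x * a14 x + q x * a13 x) (at x within {0..1})"
    "(a23 has_real_derivative a24 x) (at x within {0..1})"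
    "(a24 has_real_derivative a34 x + p x * a24 x + q x * a23 x + k x * a12 x) (at x within {0..1})"
    "(a34 has_real_derivative p x * a34 x + k x * a13 x) (at x within {0..1})" if x: "x \<in> {0..1}" for x
    unfolding a_defs
    by (rule DERIV_cong, (rule DERIV_diff DERIV_mult v[OF x] z[OF x])+, simp add: algebra_simps)+
  define y where "y = (\<lambda>j::nat. [a12, a13, a14, a23, a24, a34] ! j)"
  define y' where "y' = (\<lambda>(j::nat) x. [a13 x, a14 x + a23 x, a24 x + p x * a14 x + q x * a13 x, a24 x,
    a34 x + p x * a24 x + q x * a23 x + k x * a12 x, p x * a34 x + k x * a13 x] ! j)"
  \<comment> \<open>The factor 4 comes from the longest row of \<open>y'\<close>, the derivative of
    \<open>a24\<close>: each of its four terms is at least \<open>- C\<close> times the sum of the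
    negative parts.\<close>
  have nn: "0 \<le> y j x" if "j \<in> {0, 1, 2, 3, 4, 5}" "x \<in> {0..1}" for j x
  proof (rule cooperative_system_nonneg[where y = y and y' = y' and J = "{0, 1, 2, 3, 4, 5}" and C = "4 * C"])
    fix j x assume j: "j \<in> {0, 1, 2, 3, 4, 5::nat}" and x: "x \<in> {0..1::real}"
    show "(y j has_real_derivative y' j x) (at x within {0..1})"
      using j der[OF x] by (auto simp: y_def y'_def)
    define s where "s = (\<Sum>i\<in>{0, 1, 2, 3, 4, 5}. max 0 (- y i x))"
    have s: "0 \<le> s" "- s \<le> a12 x" "- s \<le> a13 x" "- s \<le> a14 x" "- s \<le> a23 x" "- s \<le> a24 x" "- s \<le> a34 x"
      unfolding s_def by (auto simp: y_def)
    have mult: "- (C * s) \<le> c * a" if "0 \<le> c" "c \<le> C" "- s \<le> a" for c a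
    proof -
      have "c * (- s) \<le> c * a" using that by (intro mult_left_mono)
      moreover have "c * s \<le> C * s" using that s(1) by (intro mult_right_mono)
      ultimately show ?thesis by simp
    qed
    have one: "- (C * s) \<le> a" if "- s \<le> a" for a using mult[of 1 a] that C(1) by simp
    have Cs: "0 \<le> C * s" using C(1) s(1) by simp
    note b = nonneg[OF x] C(2-4)[OF x]
    show "- (4 * C) * (\<Sum>i\<in>{0, 1, 2, 3, 4, 5}. max 0 (- y i x)) \<le> y' j x"
      unfolding s_def[symmetric]
      using j Cs one[OF s(2)] one[OF s(3)] one[OF s(4)] one[OF s(5)] one[OF s(6)] one[OF s(7)]
        mult[OF b(1) b(4) s(4)] mult[OF b(2) b(5) s(3)] mult[OF b(1) b(4) s(6)] mult[OF b(2) b(5) s(5)]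
        mult[OF b(3) b(6) s(2)] mult[OF b(1) b(4) s(7)] mult[OF b(3) b(6) s(3)]
      by (auto simp: y'_def)
  next
    fix j :: nat assume "j \<in> {0, 1, 2, 3, 4, 5}"
    then show "0 \<le> y j 0" by (auto simp: y_def a_defs z0 bc)
  qed (use that C(1) in auto)
  have pos: "0 \<le> a12 x" "0 \<le> a13 x" "0 \<le> a14 x" "0 \<le> a23 x" "0 \<le> a24 x" "0 \<le> a34 x" if "x \<in> {0..1}" for x
    using nn[OF _ that, of 0] nn[OF _ that, of 1] nn[OF _ that, of 2] nn[OF _ that, of 3]
      nn[OF _ that, of 4] nn[OF _ that, of 5] by (simp_all add: y_def)
  \<comment> \<open>The initial value \<open>c\<close> of \<open>a24\<close> is passed on along
    \<open>a24\<close>, \<open>a14\<close>, \<open>a13\<close>, \<open>a12\<close> by dropping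
    nonnegative terms and integrating; the lower bounds are \<open>c\<close>, \<open>c * x\<close>,
    \<open>c * x^2 / 2\<close> and, at the end point 1, \<open>c / 6\<close>. But
    \<open>a12 1 = 0\<close> by the two conditions at 1, which forces \<open>c = 0\<close>.\<close>
  define c where "c = (v1 0)\<^sup>2 + (v3 0)\<^sup>2"
  have "c \<ge> 0" by (simp add: c_def)
  have a24: "c \<le> a24 x" if x: "x \<in> {0..1}" for x
  proof -
    have "a24 0 \<le> a24 x"
      by (rule has_real_derivative_nonneg_mono01[OF der(5)]) (use x pos nonneg in auto)
    then show ?thesis by (simp add: a_defs z0 c_def power2_eq_square)
  qed
  have a14: "c * x \<le> a14 x" if x: "x \<in> {0..1}" for x
  proof -
    have "a14 0 - c * 0 \<le> a14 x - c * x"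
    proof (rule has_real_derivative_nonneg_mono01[where f = "\<lambda>x. a14 x - c * x"])
      show "((\<lambda>x. a14 x - c * x) has_real_derivative a24 y + p y * a14 y + q y * a13 y - c) (at y within {0..1})"
        if "y \<in> {0..1}" for y by (auto intro!: derivative_eq_intros der[OF that])
      show "0 \<le> a24 y + p y * a14 y + q y * a13 y - c" if "y \<in> {0..1}" for y
        using a24[OF that] pos[OF that] nonneg[OF that] by (simp add: add_increasing2)
    qed (use x in auto)
    then show ?thesis by (simp add: a_defs z0 bc)
  qed
  have a13: "c * x\<^sup>2 / 2 \<le> a13 x" if x: "x \<in> {0..1}" for x
  proof -
    have "a13 0 - c * 0\<^sup>2 / 2 \<le> a13 x - c * x\<^sup>2 / 2"
    proof (rule has_real_derivative_nonneg_mono01[where f = "\<lambda>x. a13 x - c * x\<^sup>2 / 2"])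
      show "((\<lambda>x. a13 x - c * x\<^sup>2 / 2) has_real_derivative a14 y + a23 y - c * y) (at y within {0..1})"
        if "y \<in> {0..1}" for y by (auto intro!: derivative_eq_intros der[OF that])
      show "0 \<le> a14 y + a23 y - c * y" if "y \<in> {0..1}" for y
        using a14[OF that] pos[OF that] by simp
    qed (use x in auto)
    then show ?thesis by (simp add: a_defs z0 bc)
  qed
  have "a12 0 - c * 0 ^ 3 / 6 \<le> a12 1 - c * 1 ^ 3 / 6"
  proof (rule has_real_derivative_nonneg_mono01[where f = "\<lambda>x. a12 x - c * x ^ 3 / 6"])
    show "((\<lambda>x. a12 x - c * x ^ 3 / 6) has_real_derivative a13 y - c * y\<^sup>2 / 2) (at y within {0..1})"
      if "y \<in> {0..1}" for y by (auto intro!: derivative_eq_intros der[OF that])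
    show "0 \<le> a13 y - c * y\<^sup>2 / 2" if "y \<in> {0..1}" for y using a13[OF that] by simp
  qed auto
  then have "c \<le> 0" by (simp add: a_defs z0 bc)
  then have init: "v1 0 = 0" "v3 0 = 0"
    using sum_power2_le_zero_iff[of "v1 0" "v3 0"] by (auto simp: c_def)
  \<comment> \<open>All initial data of \<open>v\<close> are now zero, so Gronwall applies to the
    sum of squares. The terms of its derivative add up to at most \<open>7 * C * N\<close>; the
    constant 8 leaves room.\<close>
  define N where "N x = (v0 x)\<^sup>2 + (v1 x)\<^sup>2 + (v2 x)\<^sup>2 + (v3 x)\<^sup>2" for x
  have "N x = 0"
  proof (rule gronwall_zero01[where N = N and K = "8 * C"])
    fix y :: real assume y: "y \<in> {0..1}"
    let ?N' = "2 * (v0 y * v1 y) + 2 * (v1 y * v2 y) + 2 * (v2 y * v3 y)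
      + 2 * (p y * (v3 y)\<^sup>2 + q y * (v2 y * v3 y) - k y * (v0 y * v3 y))"
    show "(N has_real_derivative ?N') (at y within {0..1})"
      unfolding N_def
      by (rule DERIV_cong, (rule DERIV_add DERIV_power v[OF y])+) (simp add: algebra_simps power2_eq_square)
    have N0: "0 \<le> N y" by (simp add: N_def)
    have ab: "2 * (a * b) \<le> a\<^sup>2 + b\<^sup>2" "- (2 * (a * b)) \<le> a\<^sup>2 + b\<^sup>2" for a b :: real
      using sum_squares_bound[of a b] sum_squares_bound[of "- a" b] by simp_all
    have sq: "0 \<le> (v0 y)\<^sup>2" "0 \<le> (v1 y)\<^sup>2" "0 \<le> (v2 y)\<^sup>2" "0 \<le> (v3 y)\<^sup>2" by simp_all
    have cf: "w * e \<le> C * N y" if "0 \<le> w" "w \<le> C" "e \<le> N y" for w e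
    proof -
      have "w * e \<le> w * N y" using that by (intro mult_left_mono)
      also have "\<dots> \<le> C * N y" using that N0 by (intro mult_right_mono)
      finally show ?thesis .
    qed
    note b = nonneg[OF y] C(2-4)[OF y]
    have "1 * (2 * (v0 y * v1 y)) \<le> C * N y" "1 * (2 * (v1 y * v2 y)) \<le> C * N y" "1 * (2 * (v2 y * v3 y)) \<le> C * N y"
      using C(1) ab[of "v0 y" "v1 y"] ab[of "v1 y" "v2 y"] ab[of "v2 y" "v3 y"] sq
      by (intro cf; (simp; fail | (unfold N_def, linarith)))+
    moreover have "p y * (v3 y)\<^sup>2 \<le> C * N y"
      by (rule cf[OF b(1,4)]) (use sq in \<open>unfold N_def, linarith\<close>)
    moreover have "q y * (2 * (v2 y * v3 y)) \<le> C * N y"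
      by (rule cf[OF b(2,5)]) (use ab[of "v2 y" "v3 y"] sq in \<open>unfold N_def, linarith\<close>)
    moreover have "k y * (- (2 * (v0 y * v3 y))) \<le> C * N y"
      by (rule cf[OF b(3,6)]) (use ab[of "v0 y" "v3 y"] sq in \<open>unfold N_def, linarith\<close>)
    moreover have "0 \<le> C * N y" using C(1) N0 by simp
    ultimately show "?N' \<le> 8 * C * N y" by (simp add: algebra_simps)
  qed (use \<open>x \<in> {0..1}\<close> in \<open>auto simp: N_def bc init\<close>)
  then have "(v0 x)\<^sup>2 = 0"
    using zero_le_power2[of "v0 x"] zero_le_power2[of "v1 x"] zero_le_power2[of "v2 x"] zero_le_power2[of "v3 x"]
    unfolding N_def by linarith
  then show ?thesis by simp
qed

section \<open>Injectivity of the operator\<close>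

text \<open>The energy identity is used in differential form: \<open>G\<close> collects the boundary
  terms of the integrations by parts, and \<open>- G\<close> has the nonnegative derivative
  \<open>Q\<close>. By the boundary conditions and \<open>h 0 = 0\<close> it vanishes at both ends,
  so it is constantly 0 and \<open>Q = 0\<close>. Then \<open>v2 = 0\<close>, and the affine
  function \<open>v0\<close> has zero value and slope at 1.\<close>

lemma L_kernel_trivial_nonneg:
  fixes R m :: real and v0 v1 v2 v3 v4 :: "real \<Rightarrow> real"
  assumes "R \<ge> 0"
    and v: "\<And>x. x \<in> {0..1} \<Longrightarrow> (v0 has_real_derivative v1 x) (at x within {0..1})"
      "\<And>x. x \<in> {0..1} \<Longrightarrow> (v1 has_real_derivative v2 x) (at x within {0..1})"
      "\<And>x. x \<in> {0..1} \<Longrightarrow> (v2 has_real_derivative v3 x) (at x within {0..1})"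
      "\<And>x. x \<in> {0..1} \<Longrightarrow> (v3 has_real_derivative v4 x) (at x within {0..1})"
    and eq: "\<And>x. x \<in> {0..1} \<Longrightarrow> v4 x + R * (exp x / exp 1) * (x^3 - 4 * x^2 + 4 * x) * v3 x - m^2 * v2 x
        + R * (exp x / exp 1) * (x^3 + 5 * x^2 - 2 * x - 6) * v0 x = 0"
    and bc: "v0 0 = 0" "v2 0 = 0" "v0 1 = 0" "v1 1 = 0" and x: "x \<in> {0..1}"
  shows "v0 x = 0"
proof -
  define E :: "real \<Rightarrow> real" where "E x = exp x / exp 1" for x
  define h h1 h2 h3 where "h x = E x * (x^3 - 4 * x^2 + 4 * x)" and "h1 x = E x * (x^3 - x^2 - 4 * x + 4)"
    and "h2 x = E x * (x^3 + 2 * x^2 - 6 * x)" and "h3 x = E x * (x^3 + 5 * x^2 - 2 * x - 6)" for x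
  \<comment> \<open>A positive supersolution of \<open>(3 h' w')' = h''' w\<close>; it shows \<open>\<integral> 3 h' v'\<^sup>2 + h''' v\<^sup>2 \<ge> 0\<close> by completing the square (Jacobi).\<close>
  define \<psi> :: "real \<Rightarrow> real" where "\<psi> x = 1 / 2 + x - x^2 / 4" for x
  \<comment> \<open>The logarithmic derivative of \<open>\<psi>\<close>; \<open>W1\<close> is the
    derivative of \<open>W\<close>, computed with \<open>\<psi>'' = - 1/2\<close>.\<close>
  define W where "W x = (1 - x / 2) / \<psi> x" for x
  define W1 where "W1 x = - (1 / \<psi> x) / 2 - (W x)^2" for x
  have E: "(E has_real_derivative E x) (at x within {0..1})" "E x > 0" for x
    unfolding E_def by (auto intro!: derivative_eq_intros)
  have h: "(h has_real_derivative h1 x) (at x within {0..1})" "(h1 has_real_derivative h2 x) (at x within {0..1})"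
    "(h2 has_real_derivative h3 x) (at x within {0..1})" for x
    unfolding h_def h1_def h2_def h3_def
    by (auto intro!: derivative_eq_intros E(1) simp: algebra_simps power2_eq_square power3_eq_cube)
  have \<psi>pos: "\<psi> x > 0" if "x \<in> {0..1}" for x
  proof -
    have "x\<^sup>2 \<le> x" using that by (simp add: power2_eq_square mult_left_le)
    then show ?thesis using that by (simp add: \<psi>_def)
  qed
  have \<psi>': "(\<psi> has_real_derivative 1 - x / 2) (at x within {0..1})" for x
    unfolding \<psi>_def by (auto intro!: derivative_eq_intros)
  have W: "(W has_real_derivative W1 x) (at x within {0..1})" if "x \<in> {0..1}" for x
    unfolding W_def W1_def
    by (rule derivative_eq_intros \<psi>' refl | use \<psi>pos[OF that] in \<open>simp add: field_simps power2_eq_square\<close>)+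
  \<comment> \<open>The term with \<open>W\<close> is the one that completes the square: subtracting
    the derivative of \<open>3 * h1 * W * v0^2\<close> from \<open>3 * h1 * v1^2 + h3 * v0^2\<close>
    leaves \<open>3 * h1 * (v1 - W * v0)^2\<close> and a multiple of \<open>v0^2\<close>.\<close>
  define G where "G x = v0 x * v3 x - v1 x * v2 x - m\<^sup>2 * (v0 x * v1 x)
    + R * (h x * (v0 x * v2 x) - h1 x * (v0 x * v1 x) - h x * (v1 x)\<^sup>2 / 2 + h2 x * (v0 x)\<^sup>2 / 2
           + 3 / 2 * (h1 x * (W x * (v0 x)\<^sup>2)))" for x
  define Q where "Q x = (v2 x)\<^sup>2 + m\<^sup>2 * (v1 x)\<^sup>2
    + R / 2 * (3 * h1 x * (v1 x - W x * v0 x)\<^sup>2 + (h3 x - 3 * h2 x * W x - 3 * h1 x * (W1 x + (W x)\<^sup>2)) * (v0 x)\<^sup>2)" for x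
  have G: "((\<lambda>x. - G x) has_real_derivative Q x) (at x within {0..1})" if x: "x \<in> {0..1}" for x
  proof -
    have "v4 x = m\<^sup>2 * v2 x - R * h x * v3 x - R * h3 x * v0 x"
      using eq[OF x] by (simp add: h_def h3_def E_def algebra_simps)
    then show ?thesis
      unfolding G_def Q_def
      by (auto intro!: derivative_eq_intros v[OF x] h W[OF x] simp: field_simps power2_eq_square) algebra
  qed
  have Qge: "(v2 x)\<^sup>2 \<le> Q x" if x: "x \<in> {0..1}" for x
  proof -
    \<comment> \<open>\<open>E x * T\<close> equals
      \<open>\<psi> * h''' - 3 * (h' * \<psi>')'\<close>, so \<open>T \<ge> 0\<close> is the
      supersolution property. Its part of degree at most 3, lowered by 1, has the factor
      \<open>1 - x\<close>; the rest \<open>1 + 5/4 * x^4 - x^5 / 4\<close> is positive because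
      \<open>x^5 \<le> x^4\<close>.\<close>
    define T where "T = 3 + 5 * x - 29 / 2 * x^2 + 15 / 2 * x^3 + 5 / 4 * x^4 - x^5 / 4"
    have h1n: "h1 x \<ge> 0"
    proof -
      have "x^3 - x^2 - 4 * x + 4 = (1 - x) * (4 - x^2)" by (simp add: algebra_simps power2_eq_square power3_eq_cube)
      moreover have "x\<^sup>2 \<le> 1" using x by (simp add: power_le_one)
      ultimately show ?thesis using x E(2)[of x] unfolding h1_def by simp
    qed
    have "T \<ge> 0"
    proof -
      have "x^5 \<le> x^4" using x by (intro power_decreasing) auto
      moreover have "0 \<le> x^4" by simp
      moreover have "x\<^sup>2 \<le> x" using x by (simp add: power2_eq_square mult_left_le)
      then have "0 \<le> (1 - x) * (2 + 7 * x - 15 / 2 * x^2)"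
        using x by (intro mult_nonneg_nonneg) auto
      moreover have "(1 - x) * (2 + 7 * x - 15 / 2 * x^2) = 2 + 5 * x - 29 / 2 * x^2 + 15 / 2 * x^3"
        by algebra
      ultimately show ?thesis unfolding T_def by linarith
    qed
    have "\<psi> x * (h3 x - 3 * h2 x * W x - 3 * h1 x * (W1 x + (W x)\<^sup>2))
        = \<psi> x * h3 x - 3 * h2 x * (1 - x / 2) + 3 / 2 * h1 x"
      using \<psi>pos[OF x] by (simp add: W1_def W_def field_simps)
    also have "\<dots> = E x * T"
      unfolding \<psi>_def h1_def h2_def h3_def T_def by algebra
    finally have "\<psi> x * (h3 x - 3 * h2 x * W x - 3 * h1 x * (W1 x + (W x)\<^sup>2)) \<ge> 0"
      using \<open>T \<ge> 0\<close> E(2)[of x] by simp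
    then have "h3 x - 3 * h2 x * W x - 3 * h1 x * (W1 x + (W x)\<^sup>2) \<ge> 0"
      using \<psi>pos[OF x] by (simp add: zero_le_mult_iff)
    then show ?thesis using h1n \<open>R \<ge> 0\<close> unfolding Q_def by simp
  qed
  have Gend: "G 0 = 0" "G 1 = 0" by (simp_all add: G_def bc h_def)
  have Q0: "0 \<le> Q x" if "x \<in> {0..1}" for x
    using Qge[OF that] zero_le_power2[of "v2 x"] by linarith
  have G0: "- G x = 0" if x: "x \<in> {0..1}" for x
    using has_real_derivative_nonneg_mono01[OF G Q0, of 0 x] has_real_derivative_nonneg_mono01[OF G Q0, of x 1] x Gend
    by simp
  have v2: "v2 x = 0" if x: "x \<in> {0..1}" for x
  proof -
    have "((\<lambda>_. 0) has_real_derivative Q x) (at x within {0..1})"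
      using has_real_derivative_cong01[of "\<lambda>x. - G x" "\<lambda>_. 0", OF G0 x] G[OF x] by simp
    then have "Q x = 0" using D_eqI[OF _ x] D_eqI[OF DERIV_const x] by metis
    then show ?thesis using Qge[OF x] by simp
  qed
  have const: "f x = f 1" if "\<And>x. x \<in> {0..1} \<Longrightarrow> (f has_real_derivative 0) (at x within {0..1})" "x \<in> {0..1}"
    for f :: "real \<Rightarrow> real" and x
  proof -
    have "norm (f x - f 1) \<le> 0 * norm (x - 1)"
      by (rule field_differentiable_bound[of "{0..1}" f "\<lambda>_. 0"]) (use that in auto)
    then show ?thesis by simp
  qed
  have "v1 x = 0" if "x \<in> {0..1}" for x using const[of v1 x] v(2) v2 bc that by auto
  then show ?thesis using const[of v0 x] v(1) bc x by auto
qed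

lemma L_kernel_trivial:
  fixes R m :: real and v0 v1 v2 v3 v4 :: "real \<Rightarrow> real"
  assumes v: "\<And>x. x \<in> {0..1} \<Longrightarrow> (v0 has_real_derivative v1 x) (at x within {0..1})"
      "\<And>x. x \<in> {0..1} \<Longrightarrow> (v1 has_real_derivative v2 x) (at x within {0..1})"
      "\<And>x. x \<in> {0..1} \<Longrightarrow> (v2 has_real_derivative v3 x) (at x within {0..1})"
      "\<And>x. x \<in> {0..1} \<Longrightarrow> (v3 has_real_derivative v4 x) (at x within {0..1})"
    and eq: "\<And>x. x \<in> {0..1} \<Longrightarrow> v4 x + R * (exp x / exp 1) * (x^3 - 4 * x^2 + 4 * x) * v3 x - m^2 * v2 x
        + R * (exp x / exp 1) * (x^3 + 5 * x^2 - 2 * x - 6) * v0 x = 0"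
    and bc: "v0 0 = 0" "v2 0 = 0" "v0 1 = 0" "v1 1 = 0" and x: "x \<in> {0..1}"
  shows "v0 x = 0"
proof (cases "R \<ge> 0")
  case True
  then show ?thesis using assms by (rule L_kernel_trivial_nonneg)
next
  case False
  define p q k :: "real \<Rightarrow> real" where "p x = (- R) * (exp x / exp 1) * (x^3 - 4 * x^2 + 4 * x)"
    and "q x = m\<^sup>2" and "k x = (- R) * (exp x / exp 1) * (6 + 2 * x - 5 * x^2 - x^3)" for x
  show ?thesis
  proof (rule fourth_order_boundary_problem_unique[of p q k v0 v1 v2 v3])
    show "continuous_on {0..1} p" "continuous_on {0..1} q" "continuous_on {0..1} k"
      unfolding p_def q_def k_def by (intro continuous_intros; simp)+
    fix x :: real assume x: "x \<in> {0..1}"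
    have "x^3 - 4 * x^2 + 4 * x = x * (x - 2)\<^sup>2" by (simp add: algebra_simps power2_eq_square power3_eq_cube)
    then show "0 \<le> p x" using False x unfolding p_def by (intro mult_nonneg_nonneg) auto
    show "0 \<le> q x" by (simp add: q_def)
    have "x\<^sup>2 \<le> x" "x^3 \<le> x" using x power_decreasing[of 1 2 x] power_decreasing[of 1 3 x] by auto
    \<comment> \<open>Bounding both powers by \<open>x\<close> leaves \<open>6 - 4 * x\<close> as a
      lower bound of the cubic in \<open>k\<close>.\<close>
    then show "0 \<le> k x" using False x unfolding k_def by (intro mult_nonneg_nonneg) auto
    have "v4 x = p x * v3 x + q x * v2 x - k x * v0 x"
      using eq[OF x] unfolding p_def q_def k_def divide_inverse by algebra
    then show "(v3 has_real_derivative p x * v3 x + q x * v2 x - k x * v0 x) (at x within {0..1})"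
      using v(4)[OF x] by simp
  qed (use assms in auto)
qed

section \<open>Convergence of the expansion\<close>

lemma abs_continuous_on_imp_continuous:
  assumes "abs_continuous_on {a..b} f"
  shows "continuous_on {a..b} f"
  unfolding continuous_on_iff
proof (intro ballI allI impI)
  fix x e :: real assume x: "x \<in> {a..b}" and "e > 0"
  obtain d where d: "d > 0" "\<forall>(n::nat) l r. (\<forall>i<n. l i \<le> r i \<and> {l i..r i} \<subseteq> {a..b}) \<and>
        disjoint_family_on (\<lambda>i. {l i<..<r i}) {..<n} \<and> (\<Sum>i<n. r i - l i) < d \<longrightarrow>
        (\<Sum>i<n. \<bar>f (r i) - f (l i)\<bar>) < e"
    using assms \<open>e > 0\<close> unfolding abs_continuous_on_def by blast
  have one: "\<bar>f r - f l\<bar> < e" if "l \<le> r" "l \<in> {a..b}" "r \<in> {a..b}" "r - l < d" for l r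
    using spec[OF spec[OF spec[OF d(2), of 1], of "\<lambda>_. l"], of "\<lambda>_. r"] that
    by (simp add: disjoint_family_on_def)
  have "dist (f y) (f x) < e" if "y \<in> {a..b}" "dist y x < d" for y
    using one[of x y] one[of y x] x that by (cases "x \<le> y") (auto simp: dist_real_def abs_minus_commute)
  then show "\<exists>d>0. \<forall>x'\<in>{a..b}. dist x' x < d \<longrightarrow> dist (f x') (f x) < e"
    using d(1) by blast
qed

text \<open>The embedding turns the Cauchy property in the norm into uniform Cauchy sequences of all
  derivatives up to order \<open>m\<close>, and uniform convergence of two consecutive orders allows
  termwise differentiation. The derivative of order \<open>Suc m\<close> is controlled only in L2,
  so the tower \<open>E\<close> stops at \<open>m\<close>.\<close>

lemma sobolev_Cauchy_limit:
  assumes e: "\<And>n. e n \<in> sobolev (Suc m)"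
    and Cauchy: "\<And>\<epsilon>. \<epsilon> > 0 \<Longrightarrow> \<exists>N. \<forall>a\<ge>N. \<forall>b\<ge>N.
      sobolev_inner (Suc m) (\<lambda>x. e a x - e b x) (\<lambda>x. e a x - e b x) < \<epsilon>"
  obtains E where "\<And>k. k \<le> m \<Longrightarrow> uniform_limit {0..1} (\<lambda>n. (D ^^ k) (e n)) (E k) sequentially"
    "\<And>k. k \<le> m \<Longrightarrow> continuous_on {0..1} (E k)"
    "\<And>k x. k < m \<Longrightarrow> x \<in> {0..1} \<Longrightarrow> (E k has_real_derivative E (Suc k) x) (at x within {0..1})"
proof -
  define E where "E = (\<lambda>k x. lim (\<lambda>n. (D ^^ k) (e n) x))"
  have lim: "uniform_limit {0..1} (\<lambda>n. (D ^^ k) (e n)) (E k) sequentially" if "k \<le> m" for k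
    unfolding E_def uniformly_convergent_uniform_limit_iff[symmetric]
  proof (rule Cauchy_uniformly_convergent, unfold uniformly_Cauchy_on_def, intro allI impI)
    fix \<epsilon> :: real assume "\<epsilon> > 0"
    define \<delta> where "\<delta> = \<epsilon> / (real m + 2)"
    have "\<delta> > 0" using \<open>\<epsilon> > 0\<close> by (simp add: \<delta>_def)
    then obtain N where N: "\<And>a b. a \<ge> N \<Longrightarrow> b \<ge> N \<Longrightarrow>
        sobolev_inner (Suc m) (\<lambda>x. e a x - e b x) (\<lambda>x. e a x - e b x) < \<delta>\<^sup>2"
      using Cauchy[of "\<delta>\<^sup>2"] by auto
    have "dist ((D ^^ k) (e a) x) ((D ^^ k) (e b) x) < \<epsilon>" if "x \<in> {0..1}" "a \<ge> N" "b \<ge> N" for x a b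
    proof -
      let ?w = "\<lambda>x. e a x - e b x"
      have w: "\<forall>x\<in>{0..1}. ?w x = 1 * e a x + (-1) * e b x" by simp
      have wS: "?w \<in> sobolev (Suc m)" by (rule sobolev_lincomb[OF e e _ w]) simp
      have "sqrt (sobolev_inner (Suc m) ?w ?w) < \<delta>"
        using N[OF that(2,3)] \<open>\<delta> > 0\<close> by (intro real_less_lsqrt) auto
      then have "(real m + 2) * sqrt (sobolev_inner (Suc m) ?w ?w) < \<epsilon>"
        by (simp add: \<delta>_def field_simps)
      moreover have "(D ^^ k) ?w x = 1 * (D ^^ k) (e a) x + (-1) * (D ^^ k) (e b) x"
        by (rule sobolev_D_iter_lincomb[OF e e w _ that(1)]) (use \<open>k \<le> m\<close> in simp)
      ultimately show ?thesis
        using sobolev_embedding[OF wS \<open>k \<le> m\<close> that(1)] by (simp add: dist_real_def)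
    qed
    then show "\<exists>M. \<forall>x\<in>{0..1}. \<forall>a\<ge>M. \<forall>b\<ge>M. dist ((D ^^ k) (e a) x) ((D ^^ k) (e b) x) < \<epsilon>"
      by blast
  qed
  have cont: "continuous_on {0..1} (E k)" if "k \<le> m" for k
    by (rule uniform_limit_theorem[OF _ lim[OF that]])
       (use that in \<open>auto intro!: always_eventually abs_continuous_on_imp_continuous sobolev_abs_continuous[OF e]\<close>)
  have der: "(E k has_real_derivative E (Suc k) x) (at x within {0..1})" if "k < m" and x: "x \<in> {0..1}" for k x
  proof -
    have "\<exists>g. \<forall>x\<in>{0..1}. (\<lambda>n. (D ^^ k) (e n) x) \<longlonglongrightarrow> g x \<and> (g has_derivative (*) (E (Suc k) x)) (at x within {0..1})"
    proof (rule has_derivative_sequence[where f' = "\<lambda>n x. (*) ((D ^^ Suc k) (e n) x)" and ?x0.0 = 0])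
      show "((D ^^ k) (e n) has_derivative (*) ((D ^^ Suc k) (e n) x)) (at x within {0..1})" if "x \<in> {0..1}" for n x
        using sobolev_has_derivative[OF e, of k x n] that \<open>k < m\<close> unfolding has_field_derivative_def by simp
      show "\<forall>\<^sub>F n in sequentially. \<forall>x\<in>{0..1}. \<forall>h. norm ((D ^^ Suc k) (e n) x * h - E (Suc k) x * h) \<le> \<epsilon> * norm h"
        if "\<epsilon> > 0" for \<epsilon>
      proof -
        have "\<forall>\<^sub>F n in sequentially. \<forall>x\<in>{0..1}. dist ((D ^^ Suc k) (e n) x) (E (Suc k) x) < \<epsilon>"
          using lim[of "Suc k"] \<open>k < m\<close> \<open>\<epsilon> > 0\<close> by (intro uniform_limitD) auto
        then show ?thesis
        proof eventually_elim
          case (elim n)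
          show ?case
          proof (intro ballI allI)
            fix x h :: real assume "x \<in> {0..1}"
            then have "\<bar>(D ^^ Suc k) (e n) x - E (Suc k) x\<bar> * \<bar>h\<bar> \<le> \<epsilon> * \<bar>h\<bar>"
              using elim by (intro mult_right_mono) (auto simp: dist_real_def less_imp_le)
            then show "norm ((D ^^ Suc k) (e n) x * h - E (Suc k) x * h) \<le> \<epsilon> * norm h"
              by (simp only: real_norm_def abs_mult[symmetric] left_diff_distrib[symmetric])
          qed
        qed
      qed
      show "(\<lambda>n. (D ^^ k) (e n) 0) \<longlonglongrightarrow> E k 0"
        using tendsto_uniform_limitI[OF lim[of k], of 0] \<open>k < m\<close> by simp
    qed auto
    then obtain g where g: "\<And>x. x \<in> {0..1} \<Longrightarrow> (\<lambda>n. (D ^^ k) (e n) x) \<longlonglongrightarrow> g x"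
      "\<And>x. x \<in> {0..1} \<Longrightarrow> (g has_real_derivative E (Suc k) x) (at x within {0..1})"
      unfolding has_field_derivative_def by blast
    have "g y = E k y" if "y \<in> {0..1}" for y
      using LIMSEQ_unique[OF g(1)[OF that] tendsto_uniform_limitI[OF lim that]] \<open>k < m\<close> by simp
    then show ?thesis using has_real_derivative_cong01[of g "E k" x] g(2)[OF x] x by simp
  qed
  show thesis by (rule that[of E]) (use lim cont der in auto)
qed

lemma W5_lincomb:
  assumes u: "u \<in> W5" and v: "v \<in> W5" and w: "\<forall>x\<in>{0..1}. w x = a * u x + b * v x"
  shows "w \<in> W5"
proof -
  note S = W5_sobolev[OF u] W5_sobolev[OF v]
  have "D w 1 = a * D u 1 + b * D v 1" using sobolev_D_iter_lincomb[OF S w, of 1 1] by simp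
  moreover have "(D ^^ 2) w 0 = a * (D ^^ 2) u 0 + b * (D ^^ 2) v 0"
    by (rule sobolev_D_iter_lincomb[OF S w]) auto
  ultimately show ?thesis
    using u v w sobolev_lincomb[OF S _ w] by (simp add: W5_def)
qed

lemma W5_sum:
  fixes f :: "nat \<Rightarrow> real \<Rightarrow> real"
  assumes f: "\<And>k. k \<ge> 1 \<Longrightarrow> f k \<in> W5"
    and w: "\<forall>x\<in>{0..1}. w x = (\<Sum>k=1..n. b k * f k x)"
  shows "w \<in> W5 \<and> (\<forall>z\<in>sobolev 5. sobolev_inner 5 w z = (\<Sum>k=1..n. b k * sobolev_inner 5 (f k) z))"
  using w
proof (induction n arbitrary: w)
  \<comment> \<open>The empty sum is written as a combination of \<open>f 1\<close> with zero
    coefficients, to fit the lemmas on linear combinations.\<close>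
  case 0
  have f1: "f 1 \<in> W5" by (rule f) simp
  have w0: "\<forall>x\<in>{0..1}. w x = 0 * f 1 x + 0 * f 1 x" using 0 by simp
  show ?case
    using W5_lincomb[OF f1 f1 w0]
      sobolev_inner_lincomb[OF W5_sobolev[OF f1] W5_sobolev[OF f1] _ zero_less_numeral w0] by simp
next
  case (Suc n)
  define w' where "w' x = (\<Sum>k=1..n. b k * f k x)" for x
  have "\<forall>x\<in>{0..1}. w' x = (\<Sum>k=1..n. b k * f k x)" by (simp add: w'_def)
  then have w': "w' \<in> W5" "\<forall>z\<in>sobolev 5. sobolev_inner 5 w' z = (\<Sum>k=1..n. b k * sobolev_inner 5 (f k) z)"
    using Suc.IH by blast+
  have fS: "f (Suc n) \<in> W5" by (rule f) simp
  have ww: "\<forall>x\<in>{0..1}. w x = 1 * w' x + b (Suc n) * f (Suc n) x"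
    using Suc.prems by (simp add: w'_def)
  show ?case
    using W5_lincomb[OF w'(1) fS ww] w'(2)
      sobolev_inner_lincomb[OF W5_sobolev[OF w'(1)] W5_sobolev[OF fS] _ zero_less_numeral ww] by simp
qed

theorem theorem3p2:
  fixes R m :: real
    and xs :: "nat \<Rightarrow> real"
    and r :: "real \<Rightarrow> real \<Rightarrow> real"
    and \<Psi> \<Psi>o :: "nat \<Rightarrow> real \<Rightarrow> real"
    and \<beta> :: "nat \<Rightarrow> nat \<Rightarrow> real"
    and u :: "real \<Rightarrow> real"
  assumes "\<forall>i\<ge>1. xs i \<in> {0..1}"
    and "{0..1} \<subseteq> closure (xs ` {1..})"
    and "reproducing_kernel W4 (sobolev_inner 4) r"
    and "\<forall>i\<ge>1. adjoint_value (L_op R m) (r (xs i)) (\<Psi> i)"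
    and "gram_schmidt (sobolev_inner 5) \<Psi> \<beta> \<Psi>o"
    and "u \<in> W5"
    and "\<forall>x\<in>{0..1}. L_op R m u x = M_fun R m x (u x) ((D ^^ 3) u x)"
    and "u 0 = 0" and "u 1 = 0" and "D u 1 = 0" and "(D ^^ 2) u 0 = 0"
  shows "\<forall>x\<in>{0..1}.
           (\<lambda>n. \<Sum>k=1..Suc n. \<beta> (Suc n) k * M_fun R m (xs k) (u (xs k)) ((D ^^ 3) u (xs k))
                  * \<Psi>o (Suc n) x) sums u x"
proof -
  let ?ip = "sobolev_inner 5"
  have \<Psi>: "\<Psi> i \<in> W5" if "i \<ge> 1" for i using assms(4) that by (simp add: adjoint_value_def)
  have L_\<Psi>: "L_op R m v (xs i) = ?ip v (\<Psi> i)" if "i \<ge> 1" "v \<in> W5" for i v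
    using L_op_eq_inner_adjoint[OF assms(3)] assms(1,4) that by blast
  have \<beta>: "\<beta> i i > 0" and \<Psi>o_sum: "\<forall>t\<in>{0..1}. \<Psi>o i t = (\<Sum>k=1..i. \<beta> i k * \<Psi> k t)" if "i \<ge> 1" for i
    using assms(5) that by (auto simp: gram_schmidt_def)
  have orth: "?ip (\<Psi>o i) (\<Psi>o j) = (if i = j then 1 else 0)" if "i \<ge> 1" "j \<ge> 1" for i j
    using assms(5) that by (auto simp: gram_schmidt_def)
  have \<Psi>o: "\<Psi>o i \<in> W5" if "i \<ge> 1" for i
    using W5_sum[of \<Psi>, OF \<Psi> \<Psi>o_sum[OF that]] by blast
  have ip_\<Psi>o: "?ip v (\<Psi>o i) = (\<Sum>k=1..i. \<beta> i k * ?ip v (\<Psi> k))" if "i \<ge> 1" "v \<in> W5" for i v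
    using W5_sum[of \<Psi>, OF \<Psi> \<Psi>o_sum[OF that(1)]] W5_sobolev[OF that(2)]
    by (simp add: sobolev_inner_commute)

  define c where "c i = ?ip u (\<Psi>o i)" for i
  \<comment> \<open>The orthonormal system is indexed from 1, so \<open>Suc\<close> makes
    \<open>e n\<close> the remainder after the terms 1 to \<open>n\<close>, with
    \<open>e 0 = u\<close>.\<close>
  define e where "e n x = u x - (\<Sum>i<n. c (Suc i) * \<Psi>o (Suc i) x)" for n x
  have eSuc: "\<forall>x\<in>{0..1}. e (Suc n) x = 1 * e n x + (- c (Suc n)) * \<Psi>o (Suc n) x" for n
    by (simp add: e_def)
  have "e 0 = u" by (simp add: e_def[abs_def])
  have e: "e n \<in> W5" for n
  proof (induction n)
    case (Suc n)
    show ?case by (rule W5_lincomb[OF Suc \<Psi>o eSuc]) simp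
  qed (simp add: \<open>e 0 = u\<close> assms)
  note eS = W5_sobolev[OF e] and \<Psi>oS = W5_sobolev[OF \<Psi>o]
  have e_orth: "?ip (e n) (\<Psi>o j) = (if j \<le> n then 0 else c j)" if "j \<ge> 1" for n j
  proof (induction n)
    case (Suc n)
    have "?ip (e (Suc n)) (\<Psi>o j) = 1 * ?ip (e n) (\<Psi>o j) + (- c (Suc n)) * ?ip (\<Psi>o (Suc n)) (\<Psi>o j)"
      by (rule sobolev_inner_lincomb[OF eS \<Psi>oS \<Psi>oS[OF that] _ eSuc]) auto
    then show ?case using Suc orth[of "Suc n" j] that by (cases "j = Suc n") auto
  qed (use that in \<open>simp add: \<open>e 0 = u\<close> c_def\<close>)
  \<comment> \<open>Orthogonality to \<open>\<Psi>o j\<close> is carried over to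
    \<open>\<Psi> j\<close> by triangularity: the products with earlier \<open>\<Psi> k\<close>
    vanish by induction, and \<open>\<beta> j j > 0\<close>. In terms of the operator,
    \<open>L_op R m (e n)\<close> vanishes at \<open>xs 1\<close> to \<open>xs n\<close>.\<close>
  have e_\<Psi>: "?ip (e n) (\<Psi> j) = 0" if "1 \<le> j" "j \<le> n" for n j
    using that
  proof (induction j rule: less_induct)
    case (less j)
    have "0 = (\<Sum>k=1..j. \<beta> j k * ?ip (e n) (\<Psi> k))"
      using e_orth[of j n] ip_\<Psi>o[OF less(2) e, of n] less by simp
    also have "\<dots> = (\<Sum>k\<in>{j}. \<beta> j k * ?ip (e n) (\<Psi> k))"
      by (rule sum.mono_neutral_right) (use less in auto)
    finally show ?case using \<beta>[OF less(2)] by simp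
  qed

  define q where "q n = ?ip (e n) (e n)" for n
  \<comment> \<open>\<open>e a - e b\<close> is a combination of the \<open>\<Psi>o i\<close> with
    \<open>a < i \<le> b\<close>, all orthogonal to \<open>e b\<close>; the induction descends from
    \<open>b\<close> to \<open>a\<close>.\<close>
  have e_e: "?ip (e a) (e b) = q b" if "a \<le> b" for a b
    using that
  proof (induction a rule: inc_induct)
    case (step a)
    have "?ip (e (Suc a)) (e b) = 1 * ?ip (e a) (e b) + (- c (Suc a)) * ?ip (\<Psi>o (Suc a)) (e b)"
      by (rule sobolev_inner_lincomb[OF eS \<Psi>oS eS _ eSuc]) auto
    moreover have "?ip (\<Psi>o (Suc a)) (e b) = 0"
      using e_orth[of "Suc a" b] step by (simp add: sobolev_inner_commute)
    ultimately show ?case using step by simp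
  qed (simp add: q_def)
  \<comment> \<open>Pythagoras: the squared distance of two remainders is the difference of their
    squared norms. The Cauchy property thus reduces to the convergence of the decreasing real
    sequence \<open>q\<close>.\<close>
  have dist_e: "?ip (\<lambda>x. e a x - e b x) (\<lambda>x. e a x - e b x) = \<bar>q a - q b\<bar>" for a b
  proof -
    let ?w = "\<lambda>x. e a x - e b x"
    have w: "\<forall>x\<in>{0..1}. ?w x = 1 * e a x + (-1) * e b x" by simp
    have wS: "?w \<in> sobolev 5" by (rule sobolev_lincomb[OF eS eS _ w]) simp
    have "?ip ?w ?w = q a - 2 * ?ip (e a) (e b) + q b"
      using sobolev_inner_lincomb[OF eS eS wS zero_less_numeral w] sobolev_inner_lincomb[OF eS eS eS[of a] zero_less_numeral w]
        sobolev_inner_lincomb[OF eS eS eS[of b] zero_less_numeral w]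
      by (simp add: sobolev_inner_commute q_def)
    moreover have "?ip (e a) (e b) = q (max a b)"
      using e_e[of a b] e_e[of b a] by (cases "a \<le> b") (simp_all add: sobolev_inner_commute max_def)
    ultimately show ?thesis using sobolev_inner_nonneg[of 5 ?w] by (cases "a \<le> b") (simp_all add: max_def)
  qed
  have "decseq q"
  proof (rule decseq_SucI)
    fix n
    let ?w = "\<lambda>x. e n x - e (Suc n) x"
    have w: "\<forall>x\<in>{0..1}. ?w x = 1 * e n x + (-1) * e (Suc n) x" by simp
    have wS: "?w \<in> sobolev 5" by (rule sobolev_lincomb[OF eS eS _ w]) simp
    have "?ip ?w ?w = q n - q (Suc n)"
      using sobolev_inner_lincomb[OF eS eS wS zero_less_numeral w] sobolev_inner_lincomb[OF eS eS eS[of n] zero_less_numeral w]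
        sobolev_inner_lincomb[OF eS eS eS[of "Suc n"] zero_less_numeral w] e_e[of n "Suc n"]
      by (simp add: sobolev_inner_commute q_def)
    then show "q (Suc n) \<le> q n" using sobolev_inner_nonneg[of 5 ?w] by simp
  qed
  then have "convergent q"
    by (rule decseq_convergent[of q 0]) (auto simp: q_def sobolev_inner_nonneg convergent_def)
  then have "Cauchy q" by (rule convergent_Cauchy)
  have Cauchy: "\<exists>N. \<forall>a\<ge>N. \<forall>b\<ge>N. sobolev_inner (Suc 4) (\<lambda>x. e a x - e b x) (\<lambda>x. e a x - e b x) < \<epsilon>" if "\<epsilon> > 0" for \<epsilon>
    using metric_CauchyD[OF \<open>Cauchy q\<close> that] dist_e by (simp add: dist_real_def)
  obtain E where lim: "\<And>k. k \<le> 4 \<Longrightarrow> uniform_limit {0..1} (\<lambda>n. (D ^^ k) (e n)) (E k) sequentially"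
    and cont: "\<And>k. k \<le> 4 \<Longrightarrow> continuous_on {0..1} (E k)"
    and der: "\<And>k x. k < 4 \<Longrightarrow> x \<in> {0..1} \<Longrightarrow> (E k has_real_derivative E (Suc k) x) (at x within {0..1})"
    using sobolev_Cauchy_limit[of e 4, OF _ Cauchy] eS by auto
  have ptlim: "(\<lambda>n. (D ^^ k) (e n) x) \<longlonglongrightarrow> E k x" if "k \<le> 4" "x \<in> {0..1}" for k x
    by (rule tendsto_uniform_limitI[OF lim[OF that(1)] that(2)])

  \<comment> \<open>The expression of the operator with the limits \<open>E k\<close> in place of
    the derivatives; it is the pointwise limit of \<open>L_op R m (e n)\<close>.\<close>
  define LE where "LE x = E 4 x + R * (exp x / exp 1) * (x^3 - 4 * x^2 + 4 * x) * E 3 x - m^2 * E 2 x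
      + R * (exp x / exp 1) * (x^3 + 5 * x^2 - 2 * x - 6) * E 0 x" for x
  have LE_xs: "LE (xs j) = 0" if "j \<ge> 1" for j
  proof -
    have x: "xs j \<in> {0..1}" using assms(1) that by blast
    have "(\<lambda>n. L_op R m (e n) (xs j)) \<longlonglongrightarrow> LE (xs j)"
      unfolding L_op_def LE_def using ptlim[OF _ x, of 0]
      by (intro tendsto_intros ptlim x) simp_all
    moreover have "\<forall>\<^sub>F n in sequentially. L_op R m (e n) (xs j) = 0"
      using eventually_ge_at_top[of j] by eventually_elim (use L_\<Psi>[OF that e] e_\<Psi> that in auto)
    ultimately show ?thesis
      by (metis LIMSEQ_unique tendsto_eventually)
  qed
  have "closure (xs ` {1..}) \<subseteq> {0..1}"
    by (rule closure_minimal) (use assms(1) in auto)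
  then have cl: "closure (xs ` {1..}) = {0..1}" using assms(2) by auto
  have "continuous_on {0..1} LE"
    unfolding LE_def by (intro continuous_intros cont) simp_all
  then have LE: "LE x = 0" if "x \<in> {0..1}" for x
    using continuous_constant_on_closure[of "xs ` {1..}" LE 0 x] LE_xs that cl by auto
  have bc: "E 0 0 = 0" "E 0 1 = 0" "E 1 1 = 0" "E 2 0 = 0"
  proof -
    have b: "e n 0 = 0" "e n 1 = 0" "D (e n) 1 = 0" "(D ^^ 2) (e n) 0 = 0" for n
      using e[of n] by (auto simp: W5_def)
    moreover have "(D ^^ Suc 0) (e n) 1 = 0" for n using b(3) by simp
    ultimately show "E 0 0 = 0" "E 0 1 = 0" "E 1 1 = 0" "E 2 0 = 0"
      using ptlim[of 0 0] ptlim[of 0 1] ptlim[of 1 1] ptlim[of 2 0]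
      by (simp_all add: LIMSEQ_const_iff del: funpow.simps(2))
  qed
  have E0: "E 0 x = 0" if "x \<in> {0..1}" for x
  proof (rule L_kernel_trivial[of "E 0" "E 1" "E 2" "E 3" "E 4" R m])
    show "(E 0 has_real_derivative E 1 x) (at x within {0..1})" "(E 1 has_real_derivative E 2 x) (at x within {0..1})"
      "(E 2 has_real_derivative E 3 x) (at x within {0..1})" "(E 3 has_real_derivative E 4 x) (at x within {0..1})"
      if "x \<in> {0..1}" for x
      using der[OF _ that, of 0] der[OF _ that, of 1] der[OF _ that, of 2] der[OF _ that, of 3]
      by (simp_all add: eval_nat_numeral)
  qed (use LE bc that in \<open>auto simp: LE_def\<close>)
  have c: "c i = (\<Sum>k=1..i. \<beta> i k * M_fun R m (xs k) (u (xs k)) ((D ^^ 3) u (xs k)))" if "i \<ge> 1" for i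
    unfolding c_def ip_\<Psi>o[OF that assms(6)]
  proof (rule sum.cong[OF refl])
    fix k assume "k \<in> {1..i}"
    then have "k \<ge> 1" "xs k \<in> {0..1}" using assms(1) by auto
    then show "\<beta> i k * ?ip u (\<Psi> k) = \<beta> i k * M_fun R m (xs k) (u (xs k)) ((D ^^ 3) u (xs k))"
      using L_\<Psi>[OF _ assms(6)] assms(7) by metis
  qed
  show ?thesis
  proof
    fix x :: real assume x: "x \<in> {0..1}"
    have "(\<lambda>n. u x - e n x) \<longlonglongrightarrow> u x - E 0 x"
      using ptlim[of 0 x] x by (intro tendsto_intros) simp
    then have sums: "(\<lambda>n. c (Suc n) * \<Psi>o (Suc n) x) sums u x"
      using E0[OF x] by (simp add: sums_def e_def)
    have cS: "c (Suc n) = (\<Sum>k=1..Suc n. \<beta> (Suc n) k * M_fun R m (xs k) (u (xs k)) ((D ^^ 3) u (xs k)))" for n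
      by (rule c) simp
    show "(\<lambda>n. \<Sum>k=1..Suc n. \<beta> (Suc n) k * M_fun R m (xs k) (u (xs k)) ((D ^^ 3) u (xs k))
                  * \<Psi>o (Suc n) x) sums u x"
      using sums unfolding cS sum_distrib_right .
  qed
qed

end
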